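(* Let $\kappa$ be a positive integer, $\gamma$ an entire function of the form $\gamma(z)=\sum_{n=0}^\infty a_nz^n$ ($z\in\mathbb{C}$) with $a_n\ge0$ for all $n$ and $a_k>0$ for some $k\ge1$, $\|\cdot\|$ a norm on $\mathbb{R}^\kappa$ induced by an inner product, and $\mu_\gamma$ the Borel measure on $\mathbb{R}^\kappa$ given by $\mu_\gamma(\mathrm{d}x)=\gamma(\|x\|^2)\,\omega_\kappa(\mathrm{d}x)$, where $\omega_\kappa$ is $\kappa$-dimensional Lebesgue measure. Let $A$ be an invertible linear transformation of $\mathbb{R}^\kappa$. If $A$ is normal in $(\mathbb{R}^\kappa,\|\cdot\|)$ (i.e. $AA^*=A^*A$, the adjoint taken with respect to the inner product inducing $\|\cdot\|$), then the composition operator $C_A$ in $L^2(\mu_\gamma)$, given by $\mathcal{D}(C_A)=\{f\in L^2(\mu_\gamma):f\circ A\in L^2(\mu_\gamma)\}$, $C_Af=f\circ A$, is subnormal.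
   Context: A densely defined operator $S$ in a Hilbert space $\mathcal{H}$ is subnormal if there exist a Hilbert space $\mathcal{K}\supseteq\mathcal{H}$ (isometric embedding) and a normal operator $N$ in $\mathcal{K}$ with $\mathcal{D}(S)\subseteq\mathcal{D}(N)$ and $Sf=Nf$ for all $f\in\mathcal{D}(S)$. (For invertible $A$, $C_A$ is well defined and densely defined.) *)

theory Defs
  imports "HOL-Analysis.Analysis"
begin

record 'a hilb =
  hcarrier :: "'a set"
  hadd :: "'a \<Rightarrow> 'a \<Rightarrow> 'a"
  hscale :: "complex \<Rightarrow> 'a \<Rightarrow> 'a"
  hzero :: 'a
  hinner :: "'a \<Rightarrow> 'a \<Rightarrow> complex"

definition hsub :: "('a, 'b) hilb_scheme \<Rightarrow> 'a \<Rightarrow> 'a \<Rightarrow> 'a" where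
  "hsub K x y = hadd K x (hscale K (-1) y)"

definition hnorm :: "('a, 'b) hilb_scheme \<Rightarrow> 'a \<Rightarrow> real" where
  "hnorm K x = sqrt (Re (hinner K x x))"

definition hconv :: "('a, 'b) hilb_scheme \<Rightarrow> (nat \<Rightarrow> 'a) \<Rightarrow> 'a \<Rightarrow> bool" where
  "hconv K x l \<longleftrightarrow> l \<in> hcarrier K \<and> (\<lambda>n. hnorm K (hsub K (x n) l)) \<longlonglongrightarrow> 0"

definition hilbert_space :: "('a, 'b) hilb_scheme \<Rightarrow> bool" where
  "hilbert_space K \<longleftrightarrow>
     hzero K \<in> hcarrier K \<and>
     (\<forall>x\<in>hcarrier K. \<forall>y\<in>hcarrier K. hadd K x y \<in> hcarrier K) \<and>
     (\<forall>c. \<forall>x\<in>hcarrier K. hscale K c x \<in> hcarrier K) \<and>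
     (\<forall>x\<in>hcarrier K. \<forall>y\<in>hcarrier K. \<forall>z\<in>hcarrier K.
        hadd K (hadd K x y) z = hadd K x (hadd K y z)) \<and>
     (\<forall>x\<in>hcarrier K. \<forall>y\<in>hcarrier K. hadd K x y = hadd K y x) \<and>
     (\<forall>x\<in>hcarrier K. hadd K (hzero K) x = x) \<and>
     (\<forall>x\<in>hcarrier K. \<exists>y\<in>hcarrier K. hadd K x y = hzero K) \<and>
     (\<forall>c. \<forall>x\<in>hcarrier K. \<forall>y\<in>hcarrier K.
        hscale K c (hadd K x y) = hadd K (hscale K c x) (hscale K c y)) \<and>
     (\<forall>c d. \<forall>x\<in>hcarrier K. hscale K (c + d) x = hadd K (hscale K c x) (hscale K d x)) \<and>
     (\<forall>c d. \<forall>x\<in>hcarrier K. hscale K (c * d) x = hscale K c (hscale K d x)) \<and>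
     (\<forall>x\<in>hcarrier K. hscale K 1 x = x) \<and>
     (\<forall>x\<in>hcarrier K. \<forall>y\<in>hcarrier K. \<forall>z\<in>hcarrier K.
        hinner K (hadd K x y) z = hinner K x z + hinner K y z) \<and>
     (\<forall>c. \<forall>x\<in>hcarrier K. \<forall>y\<in>hcarrier K. hinner K (hscale K c x) y = c * hinner K x y) \<and>
     (\<forall>x\<in>hcarrier K. \<forall>y\<in>hcarrier K. hinner K y x = cnj (hinner K x y)) \<and>
     (\<forall>x\<in>hcarrier K. Re (hinner K x x) \<ge> 0) \<and>
     (\<forall>x\<in>hcarrier K. hinner K x x = 0 \<longrightarrow> x = hzero K) \<and>
     (\<forall>x. (\<forall>n. x n \<in> hcarrier K) \<longrightarrow>
        (\<forall>e>0. \<exists>M. \<forall>m\<ge>M. \<forall>n\<ge>M. hnorm K (hsub K (x m) (x n)) < e) \<longrightarrow>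
        (\<exists>l. hconv K x l))"

definition linear_op :: "('a, 'b) hilb_scheme \<Rightarrow> 'a set \<Rightarrow> ('a \<Rightarrow> 'a) \<Rightarrow> bool" where
  "linear_op K D T \<longleftrightarrow> D \<subseteq> hcarrier K \<and> hzero K \<in> D \<and>
     (\<forall>x\<in>D. \<forall>y\<in>D. hadd K x y \<in> D \<and> T (hadd K x y) = hadd K (T x) (T y)) \<and>
     (\<forall>c. \<forall>x\<in>D. hscale K c x \<in> D \<and> T (hscale K c x) = hscale K c (T x)) \<and>
     (\<forall>x\<in>D. T x \<in> hcarrier K)"

definition dense_in :: "('a, 'b) hilb_scheme \<Rightarrow> 'a set \<Rightarrow> bool" where
  "dense_in K D \<longleftrightarrow> (\<forall>x\<in>hcarrier K. \<forall>e>0. \<exists>y\<in>D. hnorm K (hsub K x y) < e)"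

definition closed_op :: "('a, 'b) hilb_scheme \<Rightarrow> 'a set \<Rightarrow> ('a \<Rightarrow> 'a) \<Rightarrow> bool" where
  "closed_op K D T \<longleftrightarrow> (\<forall>x l y. (\<forall>n. x n \<in> D) \<longrightarrow> hconv K x l \<longrightarrow> hconv K (\<lambda>n. T (x n)) y
      \<longrightarrow> l \<in> D \<and> T l = y)"

definition adj_dom :: "('a, 'b) hilb_scheme \<Rightarrow> 'a set \<Rightarrow> ('a \<Rightarrow> 'a) \<Rightarrow> 'a set" where
  "adj_dom K D T = {y\<in>hcarrier K. \<exists>z\<in>hcarrier K. \<forall>x\<in>D. hinner K (T x) y = hinner K x z}"

definition adj :: "('a, 'b) hilb_scheme \<Rightarrow> 'a set \<Rightarrow> ('a \<Rightarrow> 'a) \<Rightarrow> 'a \<Rightarrow> 'a" where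
  "adj K D T y = (THE z. z \<in> hcarrier K \<and> (\<forall>x\<in>D. hinner K (T x) y = hinner K x z))"

definition normal_op :: "('a, 'b) hilb_scheme \<Rightarrow> 'a set \<Rightarrow> ('a \<Rightarrow> 'a) \<Rightarrow> bool" where
  "normal_op K D N \<longleftrightarrow> linear_op K D N \<and> dense_in K D \<and> closed_op K D N \<and>
     {x\<in>D. N x \<in> adj_dom K D N} = {x\<in>adj_dom K D N. adj K D N x \<in> D} \<and>
     (\<forall>x\<in>{x\<in>D. N x \<in> adj_dom K D N}. adj K D N (N x) = N (adj K D N x))"

definition L2set :: "'a measure \<Rightarrow> ('a \<Rightarrow> complex) set" where
  "L2set M = {f. f \<in> borel_measurable M \<and> integrable M (\<lambda>x. (cmod (f x))\<^sup>2)}"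

definition L2norm :: "'a measure \<Rightarrow> ('a \<Rightarrow> complex) \<Rightarrow> real" where
  "L2norm M f = sqrt (\<integral>x. (cmod (f x))\<^sup>2 \<partial>M)"

text \<open>An operator S with domain D in L^2(M) is subnormal: D is dense, and there are a Hilbert
  space K (carrier inside a fixed large type), a linear isometric embedding V of L^2(M) into K and
  a normal operator N in K with V D \<subseteq> D(N) and N (V f) = V (S f) for f \<in> D.\<close>
definition subnormal_L2 :: "'a measure \<Rightarrow> ('a \<Rightarrow> complex) set \<Rightarrow> (('a \<Rightarrow> complex) \<Rightarrow> ('a \<Rightarrow> complex)) \<Rightarrow> bool" where
  "subnormal_L2 M D S \<longleftrightarrow>
     (\<forall>f\<in>L2set M. \<forall>e>0. \<exists>g\<in>D. L2norm M (\<lambda>x. f x - g x) < e) \<and>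
     (\<exists>(K :: (('a \<Rightarrow> complex) set) hilb) V ND N.
        hilbert_space K \<and>
        (\<forall>f\<in>L2set M. V f \<in> hcarrier K \<and> hnorm K (V f) = L2norm M f) \<and>
        (\<forall>f\<in>L2set M. \<forall>g\<in>L2set M. V (\<lambda>x. f x + g x) = hadd K (V f) (V g)) \<and>
        (\<forall>c. \<forall>f\<in>L2set M. V (\<lambda>x. c * f x) = hscale K c (V f)) \<and>
        normal_op K ND N \<and>
        (\<forall>f\<in>D. V f \<in> ND \<and> N (V f) = V (S f)))"

definition is_inner_product :: "('v::real_vector \<Rightarrow> 'v \<Rightarrow> real) \<Rightarrow> bool" where
  "is_inner_product ip \<longleftrightarrow>
     (\<forall>x y. ip x y = ip y x) \<and>
     (\<forall>x y z. ip (x + y) z = ip x z + ip y z) \<and>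
     (\<forall>c x y. ip (c *\<^sub>R x) y = c * ip x y) \<and>
     (\<forall>x. x \<noteq> 0 \<longrightarrow> ip x x > 0)"

definition gamma_real :: "(nat \<Rightarrow> real) \<Rightarrow> real \<Rightarrow> real" where
  "gamma_real a t = (\<Sum>n. a n * t ^ n)"

definition mu_gamma :: "(nat \<Rightarrow> real) \<Rightarrow> (real^'n \<Rightarrow> real^'n \<Rightarrow> real) \<Rightarrow> (real^'n) measure" where
  "mu_gamma a ip = density lborel (\<lambda>x. ennreal (gamma_real a (ip x x)))"

definition comp_dom :: "'a measure \<Rightarrow> ('a \<Rightarrow> 'a) \<Rightarrow> ('a \<Rightarrow> complex) set" where
  "comp_dom M A = {f \<in> L2set M. f \<circ> A \<in> L2set M}"

end

theory Submission
  imports Defs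
begin

text \<open>
  For \<open>f \<in> L\<^sup>2(\<mu>\<^sub>\<gamma>)\<close> consider the tensor fields \<open>F\<^sub>n(x) = sqrt a\<^sub>n \<cdot> f(x) \<cdot> x \<otimes> \<dots> \<otimes> x\<close> (\<open>n\<close> factors). As
  \<open>\<parallel>x\<parallel>^(2n)\<close> is the squared norm of the \<open>n\<close>-th tensor power of \<open>x\<close>, the map \<open>f \<mapsto> (F\<^sub>n)\<close> is an isometry
  of \<open>L\<^sup>2(\<mu>\<^sub>\<gamma>)\<close> into the direct sum over \<open>n\<close> of the Lebesgue \<open>L\<^sup>2\<close> spaces of fields of \<open>n\<close>-tensors. It
  intertwines \<open>C\<^sub>A\<close> with \<open>F\<^sub>n \<mapsto> (A\<^sup>-\<^sup>1 \<otimes> \<dots> \<otimes> A\<^sup>-\<^sup>1) (F\<^sub>n \<circ> A)\<close>. On each summand this is the product of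
  two commuting bounded normal operators, a multiple of a unitary composition operator and a
  tensor power of the normal matrix \<open>A\<^sup>-\<^sup>1\<close>, so the direct sum with its maximal domain is normal.
  In an orthonormal basis the components of an \<open>n\<close>-tensor are indexed by lists of length \<open>n\<close>, and
  the direct sum becomes \<open>L\<^sup>2\<close> of the product of a counting measure on lists with Lebesgue measure.
\<close>

section \<open>Square integrable functions\<close>

lemma L2set_iff:
  "f \<in> L2set M \<longleftrightarrow> f \<in> borel_measurable M \<and> (\<integral>\<^sup>+x. ennreal ((cmod (f x))\<^sup>2) \<partial>M) < \<infinity>"
  unfolding L2set_def by (auto simp: integrable_iff_bounded)

lemma L2setD [measurable_dest]: "f \<in> L2set M \<Longrightarrow> f \<in> borel_measurable M"
  by (simp add: L2set_def)

lemma L2set_integrable: "f \<in> L2set M \<Longrightarrow> integrable M (\<lambda>x. (cmod (f x))\<^sup>2)"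
  by (simp add: L2set_def)

lemma L2set_bound:
  assumes "g \<in> borel_measurable M" "integrable M h" "\<And>x. x \<in> space M \<Longrightarrow> (cmod (g x))\<^sup>2 \<le> h x"
  shows "g \<in> L2set M"
  unfolding L2set_def using assms(1) 
  by (auto intro!: Bochner_Integration.integrable_bound[OF assms(2)] AE_I2
    order_trans[OF assms(3) abs_ge_self])

lemma L2set_zero: "(\<lambda>_. 0) \<in> L2set M"
  by (simp add: L2set_def)

lemma cmod_add_sq: "(cmod (x + y))\<^sup>2 \<le> 2 * (cmod x)\<^sup>2 + 2 * (cmod y)\<^sup>2"
proof -
  have "(cmod (x + y))\<^sup>2 \<le> (cmod x + cmod y)\<^sup>2"
    by (simp add: norm_triangle_ineq power_mono)
  also have "\<dots> \<le> 2 * (cmod x)\<^sup>2 + 2 * (cmod y)\<^sup>2"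
    using zero_le_power2[of "cmod x - cmod y"] by (simp add: power2_sum power2_diff)
  finally show ?thesis .
qed

lemma L2set_add: "f \<in> L2set M \<Longrightarrow> g \<in> L2set M \<Longrightarrow> (\<lambda>x. f x + g x) \<in> L2set M"
  by (rule L2set_bound[where h = "\<lambda>x. 2 * (cmod (f x))\<^sup>2 + 2 * (cmod (g x))\<^sup>2"])
     (auto simp: L2set_integrable intro: cmod_add_sq L2setD)

lemma L2set_scale: "f \<in> L2set M \<Longrightarrow> (\<lambda>x. c * f x) \<in> L2set M"
  by (rule L2set_bound[where h = "\<lambda>x. (cmod c)\<^sup>2 * (cmod (f x))\<^sup>2"])
     (auto simp: L2set_integrable norm_mult power_mult_distrib intro: L2setD)

lemma L2set_diff: "f \<in> L2set M \<Longrightarrow> g \<in> L2set M \<Longrightarrow> (\<lambda>x. f x - g x) \<in> L2set M"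
  using L2set_add[OF _ L2set_scale[of g M "-1"], of f] by simp

lemma L2set_sum:
  "(\<And>i. i \<in> I \<Longrightarrow> f i \<in> L2set M) \<Longrightarrow> (\<lambda>x. \<Sum>i\<in>I. f i x) \<in> L2set M"
  by (induction I rule: infinite_finite_induct) (auto simp: L2set_zero intro: L2set_add)

lemma L2set_indicator:
  assumes "f \<in> L2set M" "E \<in> sets M"
  shows "(\<lambda>x. indicator E x * f x) \<in> L2set M"
  by (rule L2set_bound[where h = "\<lambda>x. (cmod (f x))\<^sup>2"])
     (use assms in \<open>auto simp: L2set_integrable norm_mult indicator_def intro: L2setD\<close>)

lemma borel_measurable_cnj [measurable]:
  "f \<in> borel_measurable M \<Longrightarrow> (\<lambda>x. cnj (f x)) \<in> borel_measurable M"
  by (rule borel_measurable_continuous_on[where f = cnj]) (auto intro: continuous_intros)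

lemma L2set_prod_integrable:
  assumes "f \<in> L2set M" "g \<in> L2set M"
  shows "integrable M (\<lambda>x. f x * cnj (g x))"
proof (rule Bochner_Integration.integrable_bound)
  show "integrable M (\<lambda>x. (cmod (f x))\<^sup>2 + (cmod (g x))\<^sup>2)"
    using assms by (simp add: L2set_integrable)
  have "cmod (f x) * cmod (g x) \<le> (cmod (f x))\<^sup>2 + (cmod (g x))\<^sup>2" for x
    using zero_le_power2[of "cmod (f x) - cmod (g x)"]
      mult_nonneg_nonneg[OF norm_ge_zero[of "f x"] norm_ge_zero[of "g x"]]
    by (simp only: power2_diff)
  then show "AE x in M. norm (f x * cnj (g x)) \<le> norm ((cmod (f x))\<^sup>2 + (cmod (g x))\<^sup>2)"
    by (auto simp: norm_mult)
  show "(\<lambda>x. f x * cnj (g x)) \<in> borel_measurable M"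
    using assms by measurable
qed

section \<open>The \<open>L2\<close> inner product and the Cauchy-Schwarz inequality\<close>

definition l2ip :: "'a measure \<Rightarrow> ('a \<Rightarrow> complex) \<Rightarrow> ('a \<Rightarrow> complex) \<Rightarrow> complex" where
  "l2ip M f g = (\<integral>x. f x * cnj (g x) \<partial>M)"

lemma l2ip_add_left:
  "f \<in> L2set M \<Longrightarrow> g \<in> L2set M \<Longrightarrow> h \<in> L2set M \<Longrightarrow>
    l2ip M (\<lambda>x. f x + g x) h = l2ip M f h + l2ip M g h"
  unfolding l2ip_def by (simp add: distrib_right L2set_prod_integrable)

lemma l2ip_diff_left:
  "f \<in> L2set M \<Longrightarrow> g \<in> L2set M \<Longrightarrow> h \<in> L2set M \<Longrightarrow>
    l2ip M (\<lambda>x. f x - g x) h = l2ip M f h - l2ip M g h"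
  unfolding l2ip_def by (simp add: left_diff_distrib L2set_prod_integrable)

lemma l2ip_scale_left: "l2ip M (\<lambda>x. c * f x) g = c * l2ip M f g"
  unfolding l2ip_def by (simp add: mult.assoc)

lemma l2ip_sum_left:
  "(\<And>i. i \<in> I \<Longrightarrow> f i \<in> L2set M) \<Longrightarrow> g \<in> L2set M \<Longrightarrow>
    l2ip M (\<lambda>x. \<Sum>i\<in>I. f i x) g = (\<Sum>i\<in>I. l2ip M (f i) g)"
  unfolding l2ip_def by (simp add: sum_distrib_right L2set_prod_integrable)

lemma l2ip_sum_right:
  "(\<And>i. i \<in> I \<Longrightarrow> f i \<in> L2set M) \<Longrightarrow> g \<in> L2set M \<Longrightarrow>
    l2ip M g (\<lambda>x. \<Sum>i\<in>I. f i x) = (\<Sum>i\<in>I. l2ip M g (f i))"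
  unfolding l2ip_def by (simp add: sum_distrib_left L2set_prod_integrable)

lemma l2ip_commute: "l2ip M g f = cnj (l2ip M f g)"
  unfolding l2ip_def by (subst Bochner_Integration.integral_cnj[symmetric]) (simp add: mult.commute)

text \<open>Conjugation of both sides. It turns an adjoint relation for one operator of a pair into
  the relation for the other.\<close>

lemma l2ip_eq_flip: "l2ip M f g = l2ip M h k \<Longrightarrow> l2ip M g f = l2ip M k h"
  using l2ip_commute[of M g f] l2ip_commute[of M k h] by simp

lemma l2ip_scale_right: "l2ip M f (\<lambda>x. c * g x) = cnj c * l2ip M f g"
  by (simp add: l2ip_def mult.left_commute)

lemma l2ip_diff_right:
  "f \<in> L2set M \<Longrightarrow> g \<in> L2set M \<Longrightarrow> h \<in> L2set M \<Longrightarrow>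
    l2ip M f (\<lambda>x. g x - h x) = l2ip M f g - l2ip M f h"
  unfolding l2ip_def by (simp add: right_diff_distrib L2set_prod_integrable)

lemma l2ip_self: "l2ip M f f = complex_of_real (\<integral>x. (cmod (f x))\<^sup>2 \<partial>M)"
  unfolding l2ip_def by (simp add: complex_norm_square[symmetric] flip: of_real_power)

lemma l2ip_cong_AE:
  assumes "f \<in> L2set M" "g \<in> L2set M" "f' \<in> L2set M" "g' \<in> L2set M"
    "AE x in M. f x = f' x" "AE x in M. g x = g' x"
  shows "l2ip M f g = l2ip M f' g'"
  unfolding l2ip_def
  by (rule integral_cong_AE) (use assms in \<open>auto dest!: L2setD\<close>)

lemma L2norm_sq: "(L2norm M f)\<^sup>2 = (\<integral>x. (cmod (f x))\<^sup>2 \<partial>M)"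
  unfolding L2norm_def by (simp add: integral_nonneg_AE)

lemma L2norm_nonneg: "0 \<le> L2norm M f"
  unfolding L2norm_def by (simp add: integral_nonneg_AE)

lemma nn_L2norm:
  "f \<in> L2set M \<Longrightarrow> (\<integral>\<^sup>+x. ennreal ((cmod (f x))\<^sup>2) \<partial>M) = ennreal ((L2norm M f)\<^sup>2)"
  by (simp add: L2norm_sq nn_integral_eq_integral L2set_integrable)

lemma l2ip_self_L2norm: "l2ip M f f = complex_of_real ((L2norm M f)\<^sup>2)"
  by (simp only: l2ip_self L2norm_sq)

lemma l2ip_self_eq_0:
  assumes "f \<in> L2set M" "l2ip M f f = 0"
  shows "AE x in M. f x = 0"
proof -
  have "(\<integral>x. (cmod (f x))\<^sup>2 \<partial>M) = 0" using assms(2) by (simp add: l2ip_self)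
  then have "AE x in M. (cmod (f x))\<^sup>2 = 0"
    by (subst (asm) integral_nonneg_eq_0_iff_AE) (auto simp: assms L2set_integrable)
  then show ?thesis by auto
qed

text \<open>Subtracting from \<open>f\<close> its projection onto \<open>g\<close> leaves a vector
  of squared norm \<open>|f|^2 - |<f,g>|^2 / |g|^2\<close>, which is nonnegative. If
  \<open>g\<close> has norm 0, it vanishes almost everywhere and so does the product.\<close>

lemma L2norm_Cauchy_Schwarz:
  assumes f: "f \<in> L2set M" and g: "g \<in> L2set M"
  shows "cmod (l2ip M f g) \<le> L2norm M f * L2norm M g"
proof (cases "L2norm M g = 0")
  case True
  then have "AE x in M. g x = 0" using l2ip_self_eq_0[OF g] by (simp add: l2ip_self_L2norm)
  then have "l2ip M f g = l2ip M f (\<lambda>_. 0)" by (intro l2ip_cong_AE) (auto simp: f g L2set_zero)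
  then show ?thesis using True by (simp add: l2ip_def)
next
  case False
  define c where "c = l2ip M f g / (L2norm M g)\<^sup>2"
  have c: "c * l2ip M g g = l2ip M f g"
    using False by (simp add: c_def l2ip_self_L2norm)
  let ?h = "\<lambda>x. f x - c * g x"
  have cg: "(\<lambda>x. c * g x) \<in> L2set M" by (simp add: g L2set_scale)
  have h: "?h \<in> L2set M" by (simp add: f cg L2set_diff)
  have gh: "l2ip M ?h g = 0"
    using c by (simp add: l2ip_diff_left f g cg l2ip_scale_left)
  have "l2ip M ?h ?h = l2ip M f ?h - c * l2ip M g ?h"
    by (simp add: l2ip_diff_left f g cg h l2ip_scale_left)
  also have "l2ip M g ?h = 0" using gh l2ip_commute[of M g ?h] by simp
  also have "l2ip M f ?h = l2ip M f f - cnj (c * l2ip M g f)"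
    by (simp add: l2ip_diff_right f g cg h l2ip_scale_right l2ip_commute[of M f g])
  finally have "complex_of_real ((L2norm M ?h)\<^sup>2) = (L2norm M f)\<^sup>2 - cnj (c * l2ip M g f)"
    by (simp only: l2ip_self_L2norm) simp
  also have "c * l2ip M g f = (cmod (l2ip M f g))\<^sup>2 / (L2norm M g)\<^sup>2"
    unfolding c_def l2ip_commute[of M g f] by (simp add: complex_norm_square del: of_real_power)
  finally have "(L2norm M ?h)\<^sup>2 = (L2norm M f)\<^sup>2 - (cmod (l2ip M f g))\<^sup>2 / (L2norm M g)\<^sup>2"
    by (metis complex_cnj_complex_of_real of_real_diff of_real_divide of_real_eq_iff of_real_power)
  then have "(cmod (l2ip M f g))\<^sup>2 / (L2norm M g)\<^sup>2 \<le> (L2norm M f)\<^sup>2"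
    by (smt (verit) zero_le_power2)
  then have "(cmod (l2ip M f g))\<^sup>2 \<le> (L2norm M f * L2norm M g)\<^sup>2"
    using False by (simp add: divide_le_eq power_mult_distrib)
  then show ?thesis
    by (meson L2norm_nonneg mult_nonneg_nonneg power2_le_imp_le)
qed

section \<open>Completeness of \<open>L2\<close>\<close>

lemma L2set_limit:
  assumes f: "\<And>n. f n \<in> L2set M" and l [measurable]: "l \<in> borel_measurable M"
    and lim: "AE x in M. (\<lambda>k. f k x) \<longlonglongrightarrow> l x"
    and g: "g \<in> L2set M" and b: "\<And>k. k \<ge> K \<Longrightarrow> L2norm M (\<lambda>x. g x - f k x) \<le> e" and "0 \<le> e"
  shows "l \<in> L2set M" "L2norm M (\<lambda>x. g x - l x) \<le> e"
proof -
  note [measurable] = L2setD[OF g] L2setD[OF f]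
  \<comment> \<open>Preparation for Fatou's lemma: almost everywhere the limit is a liminf, which
    depends only on the tail \<open>k \<ge> K\<close> where the bound \<open>e\<close> is
    available.\<close>
  have "(\<integral>\<^sup>+x. ennreal ((cmod (g x - l x))\<^sup>2) \<partial>M) =
        (\<integral>\<^sup>+x. liminf (\<lambda>k. ennreal ((cmod (g x - f k x))\<^sup>2)) \<partial>M)"
  proof (rule nn_integral_cong_AE, use lim in eventually_elim)
    fix x assume "(\<lambda>k. f k x) \<longlonglongrightarrow> l x"
    then have "(\<lambda>k. ennreal ((cmod (g x - f k x))\<^sup>2)) \<longlonglongrightarrow> ennreal ((cmod (g x - l x))\<^sup>2)"
      by (intro tendsto_intros tendsto_ennrealI)
    then show "ennreal ((cmod (g x - l x))\<^sup>2) = liminf (\<lambda>k. ennreal ((cmod (g x - f k x))\<^sup>2))"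
      by (intro lim_imp_Liminf[symmetric] trivial_limit_sequentially)
  qed
  also have "\<dots> \<le> liminf (\<lambda>k. \<integral>\<^sup>+x. ennreal ((cmod (g x - f k x))\<^sup>2) \<partial>M)"
    by (rule nn_integral_liminf) measurable
  also have "\<dots> \<le> limsup (\<lambda>k. \<integral>\<^sup>+x. ennreal ((cmod (g x - f k x))\<^sup>2) \<partial>M)"
    by (rule Liminf_le_Limsup) simp
  also have "\<dots> \<le> ennreal (e\<^sup>2)"
  proof (rule Limsup_bounded, unfold eventually_sequentially, intro exI allI impI)
    fix k assume "K \<le> k"
    then show "(\<integral>\<^sup>+x. ennreal ((cmod (g x - f k x))\<^sup>2) \<partial>M) \<le> ennreal (e\<^sup>2)"
      using b[of k] by (subst nn_L2norm)
        (auto simp: L2set_diff f g L2norm_nonneg intro!: ennreal_leI power_mono)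
  qed
  finally have le: "(\<integral>\<^sup>+x. ennreal ((cmod (g x - l x))\<^sup>2) \<partial>M) \<le> ennreal (e\<^sup>2)" .
  have gl: "(\<lambda>x. g x - l x) \<in> L2set M"
    unfolding L2set_iff using le by (auto simp: le_less_trans)
  from L2set_diff[OF g gl] show "l \<in> L2set M" by simp
  from le have "(L2norm M (\<lambda>x. g x - l x))\<^sup>2 \<le> e\<^sup>2"
    by (simp add: nn_L2norm[OF gl])
  then show "L2norm M (\<lambda>x. g x - l x) \<le> e"
    using \<open>0 \<le> e\<close> power2_le_imp_le by blast
qed

text \<open>The weights \<open>2^k\<close> replace Minkowski's inequality: along a subsequence with
  \<open>\<parallel>f (s (Suc k)) - f (s k)\<parallel>\<^sup>2 \<le> 8^-k\<close>, the series of the \<open>2^k |f (s (Suc k)) - f (s k)|\<^sup>2\<close>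
  is integrable, so almost everywhere \<open>|f (s (Suc k)) x - f (s k) x| = O(2^(-k/2))\<close>.\<close>
lemma L2_subseq_AE_convergent:
  assumes f: "\<And>k. f k \<in> L2set M" 
    and d: "\<And>k. (L2norm M (\<lambda>x. f (Suc k) x - f k x))\<^sup>2 \<le> (1/8) ^ k"
  shows "AE x in M. convergent (\<lambda>k. f k x)"
proof -
  note [measurable] = L2setD[OF f]
  let ?d = "\<lambda>k x. (cmod (f (Suc k) x - f k x))\<^sup>2"
  have "(\<integral>\<^sup>+x. (\<Sum>k. ennreal (2 ^ k * ?d k x)) \<partial>M) = (\<Sum>k. \<integral>\<^sup>+x. ennreal (2 ^ k * ?d k x) \<partial>M)"
    by (rule nn_integral_suminf) measurable
  also have "\<dots> = (\<Sum>k. ennreal (2 ^ k) * (\<integral>\<^sup>+x. ennreal (?d k x) \<partial>M))"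
    by (subst nn_integral_cmult[symmetric]) (auto simp: ennreal_mult)
  also have "\<dots> = (\<Sum>k. ennreal (2 ^ k * (L2norm M (\<lambda>x. f (Suc k) x - f k x))\<^sup>2))"
    by (subst nn_L2norm) (auto simp: L2set_diff f ennreal_mult)
  also have "\<dots> \<le> (\<Sum>k. ennreal ((1/4) ^ k))"
  proof (intro suminf_le allI ennreal_leI)
    fix k
    have "2 ^ k * (L2norm M (\<lambda>x. f (Suc k) x - f k x))\<^sup>2 \<le> 2 ^ k * (1/8) ^ k"
      using d[of k] by (intro mult_left_mono) auto
    also have "\<dots> = (1/4) ^ k" by (simp flip: power_mult_distrib)
    finally show "2 ^ k * (L2norm M (\<lambda>x. f (Suc k) x - f k x))\<^sup>2 \<le> (1/4) ^ k" .
  qed auto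
  also have "\<dots> < \<infinity>"
    by (subst suminf_ennreal2) (auto simp: summable_geometric)
  finally have "AE x in M. (\<Sum>k. ennreal (2 ^ k * ?d k x)) \<noteq> \<infinity>"
    by (intro nn_integral_PInf_AE) auto
  then show ?thesis
  proof eventually_elim
    fix x assume "(\<Sum>k. ennreal (2 ^ k * ?d k x)) \<noteq> \<infinity>"
    then have "summable (\<lambda>k. 2 ^ k * ?d k x)"
      by (intro summable_suminf_not_top) auto
    then have "(\<lambda>k. 2 ^ k * ?d k x) \<longlonglongrightarrow> 0" by (rule summable_LIMSEQ_zero)
    then have "Bseq (\<lambda>k. 2 ^ k * ?d k x)" using convergentI convergent_imp_Bseq by blast
    then obtain B where B: "B > 0" "\<And>k. norm (2 ^ k * ?d k x) \<le> B" by (auto simp: Bseq_def)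
    have "norm (f (Suc k) x - f k x) \<le> sqrt B * (sqrt (1/2)) ^ k" for k
    proof -
      have "?d k x \<le> B * (1/2) ^ k" using B(2)[of k] by (simp add: field_simps power_divide)
      then have "sqrt (?d k x) \<le> sqrt (B * (1/2) ^ k)" by (rule real_sqrt_le_mono)
      then show ?thesis by (simp add: real_sqrt_mult real_sqrt_power del: real_sqrt_divide)
    qed
    moreover have "summable (\<lambda>k. sqrt B * (sqrt (1/2)) ^ k)"
      by (intro summable_mult summable_geometric) auto
    ultimately have "summable (\<lambda>k. f (Suc k) x - f k x)"
      by (rule summable_comparison_test'[rotated])
    then have "convergent (\<lambda>n. \<Sum>k<n. f (Suc k) x - f k x)"
      by (simp add: summable_iff_convergent)
    then have "convergent (\<lambda>n. f n x - f 0 x)"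
      by (simp add: sum_lessThan_telescope[of "\<lambda>n. f n x"])
    then show "convergent (\<lambda>k. f k x)"
      using convergent_add_const_iff[of "- f 0 x" "\<lambda>k. f k x"] by simp
  qed
qed

text \<open>Riesz-Fischer: a rapidly Cauchy subsequence converges almost everywhere. Fatou's lemma,
  in the form \<open>L2set_limit\<close> with a late member of the sequence as \<open>g\<close>,
  then shows that the limit is square integrable and is approached in norm by the whole
  sequence.\<close>

lemma L2_complete:
  assumes f: "\<And>n. f n \<in> L2set M"
    and Cau: "\<And>e. e > 0 \<Longrightarrow> \<exists>K. \<forall>m\<ge>K. \<forall>n\<ge>K. L2norm M (\<lambda>x. f m x - f n x) < e"
  shows "\<exists>l\<in>L2set M. (\<lambda>n. L2norm M (\<lambda>x. f n x - l x)) \<longlonglongrightarrow> 0"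
proof -
  have "\<exists>K. \<forall>m\<ge>K. \<forall>n\<ge>K. L2norm M (\<lambda>x. f m x - f n x) < sqrt ((1/8) ^ k)" for k :: nat
    by (rule Cau) simp
  then obtain K where K: "\<And>k m n. m \<ge> K k \<Longrightarrow> n \<ge> K k \<Longrightarrow>
      L2norm M (\<lambda>x. f m x - f n x) < sqrt ((1/8) ^ k)" by metis
  \<comment> \<open>Summing the \<open>K i\<close> makes \<open>s\<close> monotone with
    \<open>s k \<ge> K k\<close>; the summand \<open>k\<close> gives \<open>s k \<ge> k\<close>, so
    that late members of the subsequence are late members of the sequence.\<close>
  define s where "s k = k + (\<Sum>i\<le>k. K i)" for k
  have sK: "s k \<ge> K k" "s (Suc k) \<ge> s k" "s k \<ge> k" for k
    unfolding s_def by (auto intro: trans_le_add2 member_le_sum)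
  have "AE x in M. convergent (\<lambda>k. f (s k) x)"
  proof (rule L2_subseq_AE_convergent)
    fix k
    have "L2norm M (\<lambda>x. f (s (Suc k)) x - f (s k) x) < sqrt ((1/8) ^ k)"
      using sK[of k] by (intro K) auto
    then have "(L2norm M (\<lambda>x. f (s (Suc k)) x - f (s k) x))\<^sup>2 \<le> (sqrt ((1/8) ^ k))\<^sup>2"
      by (intro power_mono) (auto simp: L2norm_nonneg)
    then show "(L2norm M (\<lambda>x. f (s (Suc k)) x - f (s k) x))\<^sup>2 \<le> (1/8) ^ k" by simp
  qed (rule f)
  then have lim: "AE x in M. (\<lambda>k. f (s k) x) \<longlonglongrightarrow> lim (\<lambda>k. f (s k) x)"
    by (simp add: convergent_LIMSEQ_iff)
  let ?l = "\<lambda>x. lim (\<lambda>k. f (s k) x)"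
  note [measurable] = L2setD[OF f]
  have meas: "?l \<in> borel_measurable M" by measurable
  have bound: "\<exists>N. \<forall>n\<ge>N. ?l \<in> L2set M \<and> L2norm M (\<lambda>x. f n x - ?l x) \<le> e" if "e > 0" for e
  proof -
    obtain N where N: "\<And>m n. m \<ge> N \<Longrightarrow> n \<ge> N \<Longrightarrow> L2norm M (\<lambda>x. f m x - f n x) < e"
      using Cau[OF \<open>e > 0\<close>] by blast
    have *: "L2norm M (\<lambda>x. f n x - f (s k) x) \<le> e" if "n \<ge> N" "k \<ge> N" for n k
      using N[of n "s k"] that sK(3)[of k] by simp
    show ?thesis
      using L2set_limit[of "\<lambda>k. f (s k)" M, OF f meas lim f *] that by (intro exI[of _ N]) simp
  qed
  have "?l \<in> L2set M" using bound[of 1] by auto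
  moreover have "(\<lambda>n. L2norm M (\<lambda>x. f n x - ?l x)) \<longlonglongrightarrow> 0"
  proof (rule LIMSEQ_I)
    fix e :: real assume "e > 0"
    then show "\<exists>N. \<forall>n\<ge>N. norm (L2norm M (\<lambda>x. f n x - ?l x) - 0) < e"
      using bound[of "e/2"] by (force simp: L2norm_nonneg)
  qed
  ultimately show ?thesis by (intro bexI[of _ ?l])
qed

section \<open>Normality of direct sums\<close>

text \<open>Vectors are names \<open>r f\<close> rather than functions: if \<open>r\<close>
  identifies exactly the functions that agree almost everywhere, only the zero vector has norm 0, as
  a Hilbert space requires.\<close>

definition l2_space :: "'x measure \<Rightarrow> (('x \<Rightarrow> complex) \<Rightarrow> 'b) \<Rightarrow> 'b hilb" where
  "l2_space M r = (let rep = inv_into (L2set M) r in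
    \<lparr>hcarrier = r ` L2set M,
     hadd = \<lambda>h k. r (\<lambda>x. rep h x + rep k x),
     hscale = \<lambda>c h. r (\<lambda>x. c * rep h x),
     hzero = r (\<lambda>_. 0),
     hinner = \<lambda>h k. l2ip M (rep h) (rep k)\<rparr>)"

text \<open>The map \<open>r\<close> names the classes of \<open>L\<^sup>2(M)\<close> modulo equality almost everywhere inside an
  arbitrary type, because the extension space must have its carrier in a prescribed type.\<close>
locale l2_model =
  fixes M :: "'x measure" and r :: "('x \<Rightarrow> complex) \<Rightarrow> 'b"
  assumes r_eq_iff: "f \<in> L2set M \<Longrightarrow> g \<in> L2set M \<Longrightarrow> r f = r g \<longleftrightarrow> (AE x in M. f x = g x)"
begin

abbreviation "H \<equiv> l2_space M r"
abbreviation "rep \<equiv> inv_into (L2set M) r"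

lemma rep:
  assumes "f \<in> L2set M"
  shows "rep (r f) \<in> L2set M" "AE x in M. rep (r f) x = f x"
proof -
  show *: "rep (r f) \<in> L2set M" using assms by (simp add: inv_into_into)
  show "AE x in M. rep (r f) x = f x"
    using r_eq_iff[OF * assms] assms by (simp add: f_inv_into_f)
qed

lemma r_cong: "f \<in> L2set M \<Longrightarrow> g \<in> L2set M \<Longrightarrow> AE x in M. f x = g x \<Longrightarrow> r f = r g"
  using r_eq_iff by blast

lemma carrier: "hcarrier H = r ` L2set M"
  by (simp add: l2_space_def Let_def)

lemma zero: "hzero H = r (\<lambda>_. 0)"
  by (simp add: l2_space_def Let_def)

lemma add: "f \<in> L2set M \<Longrightarrow> g \<in> L2set M \<Longrightarrow> hadd H (r f) (r g) = r (\<lambda>x. f x + g x)"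
  using rep(2)[of f] rep(2)[of g] unfolding l2_space_def Let_def
  by (auto intro!: r_cong L2set_add rep(1))

lemma scale: "f \<in> L2set M \<Longrightarrow> hscale H c (r f) = r (\<lambda>x. c * f x)"
  using rep(2)[of f] unfolding l2_space_def Let_def
  by (auto intro!: r_cong L2set_scale rep(1))

lemma inner: "f \<in> L2set M \<Longrightarrow> g \<in> L2set M \<Longrightarrow> hinner H (r f) (r g) = l2ip M f g"
  unfolding l2_space_def Let_def by (auto intro!: l2ip_cong_AE rep)

lemma sub: "f \<in> L2set M \<Longrightarrow> g \<in> L2set M \<Longrightarrow> hsub H (r f) (r g) = r (\<lambda>x. f x - g x)"
  unfolding hsub_def using L2set_scale[of g M "-1"] by (simp add: add scale)

lemma norm: "f \<in> L2set M \<Longrightarrow> hnorm H (r f) = L2norm M f"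
  unfolding hnorm_def by (simp add: inner l2ip_self_L2norm L2norm_nonneg del: of_real_power)

lemma conv_iff:
  assumes "\<And>n. f n \<in> L2set M" "l \<in> L2set M"
  shows "hconv H (\<lambda>n. r (f n)) (r l) \<longleftrightarrow> (\<lambda>n. L2norm M (\<lambda>x. f n x - l x)) \<longlonglongrightarrow> 0"
  unfolding hconv_def using assms by (simp add: carrier sub norm L2set_diff)

lemma hilbert_space_H: "hilbert_space H"
proof -
  have compl: "\<exists>l. hconv H x l"
    if x: "\<forall>n. x n \<in> hcarrier H" 
      and C: "\<forall>e>0. \<exists>K. \<forall>m\<ge>K. \<forall>n\<ge>K. hnorm H (hsub H (x m) (x n)) < e" for x
  proof -
    from x have "\<forall>n. \<exists>f\<in>L2set M. x n = r f" by (auto simp: carrier)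
    then obtain f where f: "\<And>n. f n \<in> L2set M" "x = (\<lambda>n. r (f n))" by metis
    have "\<exists>K. \<forall>m\<ge>K. \<forall>n\<ge>K. L2norm M (\<lambda>x. f m x - f n x) < e" if "e > 0" for e
      using C that by (simp add: f sub norm L2set_diff)
    from L2_complete[OF f(1) this] show ?thesis
      using f conv_iff[of f] by blast
  qed
  have inv: "\<exists>y\<in>L2set M. r (\<lambda>x. f x + y x) = r (\<lambda>_. 0)" if "f \<in> L2set M" for f
    using that L2set_scale[OF that, of "-1"]
    by (intro bexI[of _ "\<lambda>x. -1 * f x"]) simp_all
  have def: "f \<in> L2set M \<Longrightarrow> l2ip M f f = 0 \<Longrightarrow> r f = r (\<lambda>_. 0)" for f
    by (intro r_cong l2ip_self_eq_0 L2set_zero)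
  show ?thesis
    unfolding hilbert_space_def 
    by (intro conjI compl allI ballI impI)
       (auto simp: carrier zero add scale inner L2set_add L2set_scale L2set_zero inv def
          l2ip_add_left l2ip_scale_left l2ip_commute[symmetric] algebra_simps l2ip_self_L2norm
          simp del: of_real_power)
qed

end

text \<open>A direct sum of bounded normal operators in abstract form: \<open>E n\<close> carries
  the first \<open>n\<close> summands, on which \<open>T\<close> maps \<open>L2\<close> into itself
  with adjoint \<open>S\<close>. Both act on arbitrary functions, so that their commutation is an
  identity free of domain questions.\<close>

locale exhausted_normal_pair = l2_model M r
  for M :: "'x measure" and r :: "('x \<Rightarrow> complex) \<Rightarrow> 'b" +
  fixes E :: "nat \<Rightarrow> 'x set" and T S :: "('x \<Rightarrow> complex) \<Rightarrow> ('x \<Rightarrow> complex)"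
  assumes E_sets [measurable]: "E n \<in> sets M"
    and E_mono: "incseq E" and E_Un: "(\<Union>n. E n) = space M"
    and T_meas: "f \<in> borel_measurable M \<Longrightarrow> T f \<in> borel_measurable M"
    and S_meas: "f \<in> borel_measurable M \<Longrightarrow> S f \<in> borel_measurable M"
    and T_add: "T (\<lambda>x. f x + g x) = (\<lambda>x. T f x + T g x)"
    and S_add: "S (\<lambda>x. f x + g x) = (\<lambda>x. S f x + S g x)"
    and T_scale: "T (\<lambda>x. c * f x) = (\<lambda>x. c * T f x)"
    and S_scale: "S (\<lambda>x. c * f x) = (\<lambda>x. c * S f x)"
    and T_cut: "T (\<lambda>x. indicator (E n) x * f x) = (\<lambda>x. indicator (E n) x * T f x)"
    and S_cut: "S (\<lambda>x. indicator (E n) x * f x) = (\<lambda>x. indicator (E n) x * S f x)"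
    and T_L2: "f \<in> L2set M \<Longrightarrow> (\<lambda>x. indicator (E n) x * T f x) \<in> L2set M"
    and S_L2: "f \<in> L2set M \<Longrightarrow> (\<lambda>x. indicator (E n) x * S f x) \<in> L2set M"
    and adjoint_cut: "f \<in> L2set M \<Longrightarrow> g \<in> L2set M \<Longrightarrow>
      l2ip M (\<lambda>x. indicator (E n) x * T f x) g = l2ip M f (\<lambda>x. indicator (E n) x * S g x)"
    and T_S: "T (S f) = S (T f)"
begin

text \<open>The axioms are symmetric in \<open>T\<close> and \<open>S\<close> once the adjoint
  relation is conjugated. Statements about the adjoint of \<open>T\<close> thereby become available
  for that of \<open>S\<close>.\<close>

lemma swap: "exhausted_normal_pair M r E S T"
proof unfold_locales
  fix f g n assume "f \<in> L2set M" "g \<in> L2set M"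
  from adjoint_cut[OF this(2,1), of n]
  show "l2ip M (\<lambda>x. indicator (E n) x * S f x) g = l2ip M f (\<lambda>x. indicator (E n) x * T g x)"
    by (rule l2ip_eq_flip[symmetric])
qed (rule E_sets E_mono E_Un T_meas S_meas T_add S_add T_scale S_scale T_cut S_cut T_L2 S_L2
      T_S[symmetric] | assumption)+

section \<open>Truncation to the sets \<open>E n\<close> and passage to the limit\<close>

abbreviation "restr n f \<equiv> (\<lambda>x. indicator (E n) x * f x :: complex)"

lemma cut_L2: "f \<in> L2set M \<Longrightarrow> restr n f \<in> L2set M"
  by (simp add: L2set_indicator)

lemma l2ip_cut: "l2ip M (restr n f) g = l2ip M f (restr n g)"
  unfolding l2ip_def by (intro Bochner_Integration.integral_cong) (auto simp: indicator_def)

lemma eventually_in_E: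
  assumes "x \<in> space M" shows "\<forall>\<^sub>F n in sequentially. x \<in> E n"
proof -
  obtain N where "x \<in> E N" using assms E_Un by blast
  then show ?thesis using E_mono unfolding eventually_sequentially incseq_def by blast
qed

lemma cut_lim: "x \<in> space M \<Longrightarrow> (\<lambda>n. restr n f x) \<longlonglongrightarrow> f x"
  by (intro tendsto_eventually) (auto intro: eventually_mono[OF eventually_in_E])

lemma l2ip_cut_lim:
  assumes f: "f \<in> L2set M" and g: "g \<in> L2set M"
  shows "(\<lambda>n. l2ip M (restr n f) g) \<longlonglongrightarrow> l2ip M f g"
  unfolding l2ip_def
proof (rule integral_dominated_convergence)
  note [measurable] = L2setD[OF f] L2setD[OF g]
  show "integrable M (\<lambda>x. norm (f x * cnj (g x)))"
    using L2set_prod_integrable[OF f g] by (rule integrable_norm)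
  show "AE x in M. (\<lambda>n. indicator (E n) x * f x * cnj (g x)) \<longlonglongrightarrow> f x * cnj (g x)"
    by (intro AE_I2 tendsto_mult tendsto_const cut_lim)
  show "AE x in M. norm (indicator (E n) x * f x * cnj (g x)) \<le> norm (f x * cnj (g x))" for n
    by (auto simp: indicator_def)
qed (use f g in \<open>measurable\<close>)

lemma L2norm_cut_lim:
  assumes f: "f \<in> L2set M"
  shows "(\<lambda>n. L2norm M (\<lambda>x. f x - restr n f x)) \<longlonglongrightarrow> 0"
proof -
  note [measurable] = L2setD[OF f]
  have "(\<lambda>n. \<integral>x. (cmod (f x - restr n f x))\<^sup>2 \<partial>M) \<longlonglongrightarrow> (\<integral>x. 0 \<partial>M)"
  proof (rule integral_dominated_convergence)
    show "integrable M (\<lambda>x. (cmod (f x))\<^sup>2)" using f by (rule L2set_integrable)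
    show "AE x in M. (\<lambda>n. (cmod (f x - restr n f x))\<^sup>2) \<longlonglongrightarrow> 0"
    proof (rule AE_I2)
      fix x assume "x \<in> space M"
      have "(\<lambda>n. (cmod (f x - restr n f x))\<^sup>2) \<longlonglongrightarrow> (cmod (f x - f x))\<^sup>2"
        by (intro tendsto_intros cut_lim \<open>x \<in> space M\<close>)
      then show "(\<lambda>n. (cmod (f x - restr n f x))\<^sup>2) \<longlonglongrightarrow> 0" by simp
    qed
    show "AE x in M. norm ((cmod (f x - restr n f x))\<^sup>2) \<le> (cmod (f x))\<^sup>2" for n
      by (auto simp: indicator_def)
  qed measurable
  then show ?thesis
    unfolding L2norm_def using tendsto_real_sqrt by fastforce
qed

text \<open>Testing the difference of the two truncations against itself shows that it vanishes
  almost everywhere, and the countably many \<open>E n\<close> exhaust the space. \<open>u\<close>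
  and \<open>v\<close> enter through their truncations because they may fail to be square integrable
  themselves.\<close>

lemma weak_eq_cut:
  assumes u: "\<And>n. restr n u \<in> L2set M" and v: "\<And>n. restr n v \<in> L2set M"
    and eq: "\<And>n g. g \<in> L2set M \<Longrightarrow> l2ip M g (restr n u) = l2ip M g (restr n v)"
  shows "AE x in M. u x = v x"
proof -
  have "AE x in M. restr n u x = restr n v x" for n
  proof -
    let ?d = "\<lambda>x. restr n u x - restr n v x"
    have d: "?d \<in> L2set M" using u v by (rule L2set_diff)
    have "l2ip M ?d ?d = 0" using eq[OF d] by (simp add: l2ip_diff_right[OF d u v])
    then show ?thesis using l2ip_self_eq_0[OF d] by simp
  qed
  then have "AE x in M. \<forall>n. restr n u x = restr n v x" unfolding AE_all_countable by blast
  then show ?thesis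
  proof (rule AE_mp, intro AE_I2 impI)
    fix x assume "x \<in> space M" "\<forall>n. restr n u x = restr n v x"
    moreover obtain N where "x \<in> E N" using \<open>x \<in> space M\<close> E_Un by blast
    ultimately show "u x = v x" by (auto dest: spec[of _ N])
  qed
qed

text \<open>Truncated functions lie in the domain of \<open>T\<close>, and testing with them
  determines \<open>S g\<close> on every \<open>E n\<close>. Square integrability of
  \<open>S g\<close> is a consequence here, not an assumption.\<close>

lemma adjoint_test:
  assumes g: "g \<in> L2set M" and h: "h \<in> L2set M"
    and eq: "\<And>f. f \<in> L2set M \<Longrightarrow> T f \<in> L2set M \<Longrightarrow> l2ip M (T f) g = l2ip M f h"
  shows "AE x in M. S g x = h x"
proof (rule weak_eq_cut)
  fix n u assume u: "u \<in> L2set M"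
  have "l2ip M u (restr n (S g)) = l2ip M (T (restr n u)) g"
    using adjoint_cut[OF u g] by (simp add: T_cut)
  also have "\<dots> = l2ip M (restr n u) h"
    by (rule eq) (simp_all add: T_cut T_L2 cut_L2 u)
  finally show "l2ip M u (restr n (S g)) = l2ip M u (restr n h)" by (simp add: l2ip_cut)
qed (simp_all add: S_L2 cut_L2 g h)

text \<open>The relation holds after truncation, and dominated convergence removes the truncation on
  both sides, as \<open>T f\<close> and \<open>S g\<close> are square integrable.\<close>

lemma adjoint_full:
  assumes "f \<in> L2set M" "T f \<in> L2set M" "g \<in> L2set M" "S g \<in> L2set M"
  shows "l2ip M (T f) g = l2ip M f (S g)"
proof -
  have "(\<lambda>n. l2ip M (restr n (T f)) g) \<longlonglongrightarrow> l2ip M (T f) g"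
    by (rule l2ip_cut_lim) fact+
  moreover have "l2ip M (restr n (T f)) g = l2ip M (restr n f) (S g)" for n
    by (simp only: adjoint_cut[OF assms(1,3)] l2ip_cut[of n f])
  moreover have "(\<lambda>n. l2ip M (restr n f) (S g)) \<longlonglongrightarrow> l2ip M f (S g)"
    by (rule l2ip_cut_lim) fact+
  ultimately show ?thesis using LIMSEQ_unique by simp
qed

text \<open>\<open>T\<close> is defined on functions, not on classes. By the adjoint relation its
  truncations are determined by inner products with \<open>f\<close>, and these see only the class
  of \<open>f\<close>.\<close>

lemma T_cong_AE:
  assumes f: "f \<in> L2set M" and g: "g \<in> L2set M" and ae: "AE x in M. f x = g x"
  shows "AE x in M. T f x = T g x"
proof (rule weak_eq_cut)
  fix n u assume u: "u \<in> L2set M"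
  have "l2ip M (restr n (T f)) u = l2ip M (restr n (T g)) u"
    unfolding adjoint_cut[OF f u] adjoint_cut[OF g u]
    by (rule l2ip_cong_AE) (auto simp: f g u S_L2 ae)
  then show "l2ip M u (restr n (T f)) = l2ip M u (restr n (T g))"
    by (rule l2ip_eq_flip)
qed (simp_all add: T_L2 f g)

lemma T_L2_cong:
  assumes "f \<in> L2set M" "g \<in> L2set M" "AE x in M. f x = g x" "T f \<in> L2set M"
  shows "T g \<in> L2set M"
proof -
  have "AE x in M. ennreal ((cmod (T f x))\<^sup>2) = ennreal ((cmod (T g x))\<^sup>2)"
    using T_cong_AE[OF assms(1-3)] by eventually_elim simp
  from nn_integral_cong_AE[OF this] show ?thesis
    using assms T_meas[OF L2setD[OF assms(2)]] unfolding L2set_iff by simp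
qed

text \<open>The characteristic identity of normal operators,
  \<open><T f, T f> = <f, S (T f)> = <f, T (S f)> = <S f, S f>\<close>, applied to a truncated
  function, for which every term is square integrable.\<close>

lemma L2norm_cut_T_S:
  assumes "f \<in> L2set M"
  shows "L2norm M (restr n (T f)) = L2norm M (restr n (S f))"
proof -
  let ?f = "restr n f"
  have f: "?f \<in> L2set M" "T ?f \<in> L2set M" "S ?f \<in> L2set M"
    using assms by (simp_all add: T_cut S_cut T_L2 S_L2 cut_L2)
  have ST: "S (T ?f) \<in> L2set M" 
  proof -
    have "(\<lambda>x. indicator (E n) x * T ?f x) = T ?f"
      unfolding T_cut by (auto simp: indicator_def)
    then show ?thesis using S_L2[OF f(2), of n] unfolding S_cut[symmetric] by simp
  qed
  have "l2ip M (T ?f) (T ?f) = l2ip M ?f (S (T ?f))"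
    by (rule adjoint_full[OF f(1,2,2) ST])
  also have "\<dots> = cnj (l2ip M (T (S ?f)) ?f)"
    unfolding T_S by (rule l2ip_commute)
  also have "\<dots> = cnj (l2ip M (S ?f) (S ?f))"
    using adjoint_full[OF f(3) _ f(1,3)] ST by (simp only: T_S)
  also have "\<dots> = l2ip M (S ?f) (S ?f)" by (rule l2ip_commute[symmetric])
  finally have "(L2norm M (T ?f))\<^sup>2 = (L2norm M (S ?f))\<^sup>2"
    unfolding l2ip_self_L2norm of_real_eq_iff .
  then show ?thesis by (simp add: T_cut S_cut L2norm_nonneg)
qed

lemma nn_integral_cut_SUP:
  assumes [measurable]: "f \<in> borel_measurable M"
  shows "(\<integral>\<^sup>+x. ennreal ((cmod (f x))\<^sup>2) \<partial>M) = (SUP n. \<integral>\<^sup>+x. ennreal ((cmod (restr n f x))\<^sup>2) \<partial>M)"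
proof (subst nn_integral_monotone_convergence_SUP[symmetric])
  show "incseq (\<lambda>n x. ennreal ((cmod (restr n f x))\<^sup>2))"
    using E_mono by (auto simp: incseq_def le_fun_def indicator_def)
  show "(\<integral>\<^sup>+x. ennreal ((cmod (f x))\<^sup>2) \<partial>M) = (\<integral>\<^sup>+x. (SUP n. ennreal ((cmod (restr n f x))\<^sup>2)) \<partial>M)"
  proof (rule nn_integral_cong)
    fix x assume "x \<in> space M"
    then obtain N where "x \<in> E N" using E_Un by blast
    then show "ennreal ((cmod (f x))\<^sup>2) = (SUP n. ennreal ((cmod (restr n f x))\<^sup>2))"
      by (intro antisym SUP_least SUP_upper2[of N]) (auto simp: indicator_def)
  qed
qed measurable

text \<open>The truncated norms agree, and monotone convergence carries the equality over to the
  full integrals even when they are infinite. Thus the maximal domains of \<open>T\<close> and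
  \<open>S\<close> coincide.\<close>

lemma T_L2_iff_S_L2:
  assumes "f \<in> L2set M"
  shows "T f \<in> L2set M \<longleftrightarrow> S f \<in> L2set M"
proof -
  note meas = T_meas[OF L2setD[OF assms]] S_meas[OF L2setD[OF assms]]
  have "(\<integral>\<^sup>+x. ennreal ((cmod (restr n (T f) x))\<^sup>2) \<partial>M)
      = (\<integral>\<^sup>+x. ennreal ((cmod (restr n (S f) x))\<^sup>2) \<partial>M)" for n
    unfolding nn_L2norm[OF T_L2[OF assms]] nn_L2norm[OF S_L2[OF assms]]
    by (simp only: L2norm_cut_T_S[OF assms])
  then have "(\<integral>\<^sup>+x. ennreal ((cmod (T f x))\<^sup>2) \<partial>M) = (\<integral>\<^sup>+x. ennreal ((cmod (S f x))\<^sup>2) \<partial>M)"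
    by (subst (1 2) nn_integral_cut_SUP) (simp_all only: meas)
  then show ?thesis
    unfolding L2set_iff using meas by simp
qed

section \<open>The maximal operator on classes, its adjoint and its normality\<close>

definition "opr_dom = r ` {f \<in> L2set M. T f \<in> L2set M}"
definition "opr h = r (T (rep h))"

lemma opr_dom_iff: "f \<in> L2set M \<Longrightarrow> r f \<in> opr_dom \<longleftrightarrow> T f \<in> L2set M"
  unfolding opr_dom_def
  by (auto simp: r_eq_iff elim!: T_L2_cong[rotated 3] simp: eq_commute[of "f _"])

lemma opr_eq:
  assumes "f \<in> L2set M" "T f \<in> L2set M"
  shows "opr (r f) = r (T f)"
proof -
  have "AE x in M. f x = rep (r f) x" using rep(2)[OF assms(1)] by eventually_elim simp
  from T_L2_cong[OF assms(1) rep(1)[OF assms(1)] this assms(2)]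
  have "T (rep (r f)) \<in> L2set M" .
  then show ?thesis unfolding opr_def
    by (intro r_cong T_cong_AE assms rep)
qed

text \<open>\<open>adjoint_test\<close> shows that the adjoint has no larger a domain than the
  maximal operator of \<open>S\<close>, and \<open>adjoint_full\<close> that it has no smaller
  one.\<close>

lemma adj_dom_iff:
  assumes g: "g \<in> L2set M"
  shows "r g \<in> adj_dom H opr_dom opr \<longleftrightarrow> S g \<in> L2set M"
proof
  assume "r g \<in> adj_dom H opr_dom opr"
  then obtain h where h: "h \<in> L2set M" 
    and eq: "\<And>f. f \<in> L2set M \<Longrightarrow> T f \<in> L2set M \<Longrightarrow> hinner H (opr (r f)) (r g) = hinner H (r f) (r h)"
    unfolding adj_dom_def by (auto simp: carrier opr_dom_def)
  have "AE x in M. S g x = h x"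
    using eq by (intro adjoint_test g h) (simp add: opr_eq inner g h)
  then have "AE x in M. ennreal ((cmod (S g x))\<^sup>2) = ennreal ((cmod (h x))\<^sup>2)"
    by eventually_elim simp
  from nn_integral_cong_AE[OF this] show "S g \<in> L2set M"
    using h S_meas[OF L2setD[OF g]] unfolding L2set_iff by simp
next
  assume S: "S g \<in> L2set M"
  show "r g \<in> adj_dom H opr_dom opr"
    unfolding adj_dom_def using g S
    by (auto simp: carrier opr_dom_def opr_eq inner adjoint_full intro!: bexI[of _ "r (S g)"])
qed

lemma adj_eq:
  assumes g: "g \<in> L2set M" and S: "S g \<in> L2set M"
  shows "adj H opr_dom opr (r g) = r (S g)"
  unfolding adj_def
proof (rule the_equality)
  show "r (S g) \<in> hcarrier H \<and> (\<forall>x\<in>opr_dom. hinner H (opr x) (r g) = hinner H x (r (S g)))"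
    using g S by (auto simp: carrier opr_dom_def opr_eq inner adjoint_full)
next
  fix z assume z: "z \<in> hcarrier H \<and> (\<forall>x\<in>opr_dom. hinner H (opr x) (r g) = hinner H x z)"
  then obtain h where h: "h \<in> L2set M" "z = r h" by (auto simp: carrier)
  have "AE x in M. S g x = h x"
  proof (rule adjoint_test[OF g h(1)])
    fix f assume f: "f \<in> L2set M" "T f \<in> L2set M"
    then have "r f \<in> opr_dom" by (simp add: opr_dom_iff)
    then have "hinner H (opr (r f)) (r g) = hinner H (r f) (r h)" using z h by blast
    then show "l2ip M (T f) g = l2ip M f h" using f g h by (simp add: opr_eq inner)
  qed
  then show "z = r (S g)" using r_eq_iff[OF S h(1)] h by simp
qed

lemma L2norm_conv_l2ip:
  assumes f: "\<And>n. f n \<in> L2set M" and l: "l \<in> L2set M" and g: "g \<in> L2set M"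
    and "(\<lambda>n. L2norm M (\<lambda>x. f n x - l x)) \<longlonglongrightarrow> 0"
  shows "(\<lambda>n. l2ip M (f n) g) \<longlonglongrightarrow> l2ip M l g"
proof (rule LIM_zero_cancel, rule Lim_null_comparison)
  show "\<forall>\<^sub>F n in sequentially. norm (l2ip M (f n) g - l2ip M l g)
      \<le> L2norm M (\<lambda>x. f n x - l x) * L2norm M g"
    using L2norm_Cauchy_Schwarz[OF L2set_diff[OF f l] g] by (simp add: l2ip_diff_left f l g)
  show "(\<lambda>n. L2norm M (\<lambda>x. f n x - l x) * L2norm M g) \<longlonglongrightarrow> 0"
    using tendsto_mult_left_zero[OF assms(4)] by simp
qed

text \<open>Adjoints are closed, and \<open>T\<close> is the adjoint of \<open>S\<close>: inner
  products with \<open>g\<close> and \<open>S g\<close> pass to the limit by Cauchy-Schwarz, after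
  which the test for the swapped pair recognises \<open>T u\<close> as \<open>h\<close>.\<close>

lemma closed_opr: "closed_op H opr_dom opr"
  unfolding closed_op_def
proof (intro allI impI)
  fix x l y
  assume x: "\<forall>n. x n \<in> opr_dom" and l: "hconv H x l" and y: "hconv H (\<lambda>n. opr (x n)) y"
  from x have "\<forall>n. \<exists>f. f \<in> L2set M \<and> T f \<in> L2set M \<and> x n = r f"
    unfolding opr_dom_def by blast
  then obtain f where f: "\<And>n. f n \<in> L2set M" "\<And>n. T (f n) \<in> L2set M" "x = (\<lambda>n. r (f n))"
    by metis
  obtain u h where u: "u \<in> L2set M" "l = r u" and h: "h \<in> L2set M" "y = r h"
    using l y by (auto simp: hconv_def carrier)
  have lu: "(\<lambda>n. L2norm M (\<lambda>x. f n x - u x)) \<longlonglongrightarrow> 0"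
    using l f u by (simp add: conv_iff)
  have yh: "(\<lambda>n. L2norm M (\<lambda>x. T (f n) x - h x)) \<longlonglongrightarrow> 0"
    using y f h by (simp add: conv_iff opr_eq)
  have ae: "AE x in M. T u x = h x"
  proof (rule exhausted_normal_pair.adjoint_test[OF swap u(1) h(1)])
    fix g assume g: "g \<in> L2set M" "S g \<in> L2set M"
    have "(\<lambda>n. l2ip M (T (f n)) g) \<longlonglongrightarrow> l2ip M h g"
      by (rule L2norm_conv_l2ip) (use f h g yh in auto)
    moreover have "(\<lambda>n. l2ip M (f n) (S g)) \<longlonglongrightarrow> l2ip M u (S g)"
      by (rule L2norm_conv_l2ip) (use f u g lu in auto)
    ultimately have "l2ip M h g = l2ip M u (S g)"
      using LIMSEQ_unique by (simp add: adjoint_full f g)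
    then show "l2ip M (S g) u = l2ip M g h" by (rule l2ip_eq_flip[symmetric])
  qed
  then have "AE x in M. ennreal ((cmod (T u x))\<^sup>2) = ennreal ((cmod (h x))\<^sup>2)"
    by eventually_elim simp
  from nn_integral_cong_AE[OF this] have Tu: "T u \<in> L2set M"
    using h T_meas[OF L2setD[OF u(1)]] unfolding L2set_iff by simp
  with ae show "l \<in> opr_dom \<and> opr l = y"
    using u h by (simp add: opr_dom_iff opr_eq r_eq_iff)
qed

lemma normal_opr: "normal_op H opr_dom opr"
proof -
  have T0: "T (\<lambda>_. 0) = (\<lambda>_. 0)" using T_scale[of 0 "\<lambda>_. 0"] by simp
  have "linear_op H opr_dom opr"
    unfolding linear_op_def
  proof (intro conjI ballI allI)
    show "opr_dom \<subseteq> hcarrier H" by (auto simp: opr_dom_def carrier)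
    show "hzero H \<in> opr_dom" by (simp add: zero opr_dom_iff L2set_zero T0)
    fix x assume "x \<in> opr_dom"
    then obtain f where f: "f \<in> L2set M" "T f \<in> L2set M" "x = r f" by (auto simp: opr_dom_def)
    show "opr x \<in> hcarrier H" using f by (simp add: opr_eq carrier)
    show "hscale H c x \<in> opr_dom" "opr (hscale H c x) = hscale H c (opr x)" for c
      using f by (simp_all add: scale opr_dom_iff opr_eq T_scale L2set_scale)
    fix y assume "y \<in> opr_dom"
    then obtain g where g: "g \<in> L2set M" "T g \<in> L2set M" "y = r g" by (auto simp: opr_dom_def)
    show "hadd H x y \<in> opr_dom" "opr (hadd H x y) = hadd H (opr x) (opr y)"
      using f g by (simp_all add: add opr_dom_iff opr_eq T_add L2set_add)
  qed
  moreover have "dense_in H opr_dom"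
    unfolding dense_in_def
  proof (intro ballI allI impI)
    fix x and e :: real assume "x \<in> hcarrier H" "e > 0"
    then obtain f where f: "f \<in> L2set M" "x = r f" by (auto simp: carrier)
    obtain n where n: "L2norm M (\<lambda>x. f x - restr n f x) < e"
      using order_tendstoD(2)[OF L2norm_cut_lim[OF f(1)] \<open>e > 0\<close>] by (auto simp: eventually_sequentially)
    show "\<exists>y\<in>opr_dom. hnorm H (hsub H x y) < e"
    proof
      show "r (restr n f) \<in> opr_dom" using f by (simp add: opr_dom_iff cut_L2 T_cut T_L2)
      show "hnorm H (hsub H x (r (restr n f))) < e"
        using n f by (simp add: sub norm cut_L2 L2set_diff)
    qed
  qed
  moreover have "{x\<in>opr_dom. opr x \<in> adj_dom H opr_dom opr} = {x\<in>adj_dom H opr_dom opr. adj H opr_dom opr x \<in> opr_dom}"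
    (is "?A = ?B")
  proof (rule set_eqI)
    fix x
    show "x \<in> ?A \<longleftrightarrow> x \<in> ?B"
    proof (cases "x \<in> hcarrier H")
      case True
      then obtain f where f: "f \<in> L2set M" "x = r f" by (auto simp: carrier)
      have "x \<in> ?A \<longleftrightarrow> T f \<in> L2set M \<and> S (T f) \<in> L2set M"
        using f by (auto simp: opr_dom_iff opr_eq adj_dom_iff)
      \<comment> \<open>\<open>T f\<close> and \<open>S f\<close> are square integrable together,
        and \<open>T (S f)\<close> is the same function as \<open>S (T f)\<close>.\<close>
      also have "\<dots> \<longleftrightarrow> S f \<in> L2set M \<and> T (S f) \<in> L2set M"
        using f by (auto simp: T_L2_iff_S_L2 T_S)
      also have "\<dots> \<longleftrightarrow> x \<in> ?B"
        using f by (auto simp: opr_dom_iff adj_eq adj_dom_iff)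
      finally show ?thesis .
    next
      case False
      then show ?thesis by (auto simp: opr_dom_def adj_dom_def carrier)
    qed
  qed
  moreover have "adj H opr_dom opr (opr x) = opr (adj H opr_dom opr x)"
    if "x \<in> opr_dom" "opr x \<in> adj_dom H opr_dom opr" for x
  proof -
    from that obtain f where f: "f \<in> L2set M" "T f \<in> L2set M" "x = r f" by (auto simp: opr_dom_def)
    then have "S (T f) \<in> L2set M" "S f \<in> L2set M"
      using that by (auto simp: opr_eq adj_dom_iff T_L2_iff_S_L2)
    then show ?thesis using f by (simp add: opr_eq adj_eq T_S)
  qed
  ultimately show ?thesis unfolding normal_op_def using closed_opr by blast
qed

end

section \<open>Tensor powers of matrices, linear substitution, inner products\<close>

lemma sum_lists_Suc:
  fixes g :: "'i::finite list \<Rightarrow> 'c::comm_monoid_add"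
  shows "(\<Sum>v | length v = Suc n. g v) = (\<Sum>j\<in>UNIV. \<Sum>v | length v = n. g (j # v))"
proof -
  have "{v::'i list. length v = Suc n} = (\<lambda>(j, v). j # v) ` (UNIV \<times> {v. length v = n})"
    by (auto simp: length_Suc_conv image_iff)
  moreover have "inj_on (\<lambda>(j, v). j # v) (UNIV \<times> {v::'i list. length v = n})"
    by (auto simp: inj_on_def)
  ultimately show ?thesis
    by (simp add: sum.reindex sum.cartesian_product case_prod_unfold)
qed

text \<open>For lists of equal length \<open>n\<close> this is an entry of the \<open>n\<close>-th
  Kronecker power of \<open>Q\<close>.\<close>

definition tensor_coeff :: "('i \<Rightarrow> 'i \<Rightarrow> real) \<Rightarrow> 'i list \<Rightarrow> 'i list \<Rightarrow> real" where
  "tensor_coeff Q w v = prod_list (map2 Q w v)"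

lemma tensor_coeff_transpose: "tensor_coeff Q w v = tensor_coeff (\<lambda>i j. Q j i) v w"
  unfolding tensor_coeff_def by (subst zip_commute) (simp add: case_prod_unfold comp_def)

text \<open>After splitting off the first letter, the sum over lists factors into a sum over that
  letter and one over the tails. This is the multiplicativity of Kronecker powers.\<close>

lemma tensor_coeff_comp:
  fixes P R :: "'i::finite \<Rightarrow> 'i \<Rightarrow> real"
  assumes "length w = n" "length u = n"
  shows "(\<Sum>v | length v = n. tensor_coeff P w v * tensor_coeff R v u)
    = tensor_coeff (\<lambda>i k. \<Sum>j\<in>UNIV. P i j * R j k) w u"
  using assms
proof (induction n arbitrary: w u)
  case 0
  then show ?case by (simp add: tensor_coeff_def)
next
  case (Suc n)
  from Suc.prems obtain i w' k u' where w: "w = i # w'" "u = k # u'" "length w' = n" "length u' = n"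
    by (auto simp: length_Suc_conv)
  have "(\<Sum>v | length v = Suc n. tensor_coeff P w v * tensor_coeff R v u)
      = (\<Sum>j\<in>UNIV. \<Sum>v | length v = n. (P i j * R j k) * (tensor_coeff P w' v * tensor_coeff R v u'))"
    unfolding sum_lists_Suc by (simp add: w tensor_coeff_def mult_ac)
  also have "\<dots> = (\<Sum>j\<in>UNIV. P i j * R j k) * tensor_coeff (\<lambda>i k. \<Sum>j\<in>UNIV. P i j * R j k) w' u'"
    by (simp add: sum_distrib_right Suc.IH w flip: sum_distrib_left)
  finally show ?case by (simp add: w tensor_coeff_def)
qed

text \<open>A Kronecker power acts factor by factor on the pure tensor
  \<open>c \<otimes> ... \<otimes> c\<close>, whose components are the monomials
  \<open>prod_list (map c v)\<close>.\<close>

lemma tensor_coeff_monomial: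
  fixes Q :: "'i::finite \<Rightarrow> 'i \<Rightarrow> real"
  assumes "length w = n"
  shows "(\<Sum>v | length v = n. tensor_coeff Q w v * prod_list (map c v))
    = prod_list (map (\<lambda>i. \<Sum>j\<in>UNIV. Q i j * c j) w)"
  using assms
proof (induction n arbitrary: w)
  case 0
  then show ?case by (simp add: tensor_coeff_def)
next
  case (Suc n)
  from Suc.prems obtain i w' where w: "w = i # w'" "length w' = n"
    by (auto simp: length_Suc_conv)
  have "(\<Sum>v | length v = Suc n. tensor_coeff Q w v * prod_list (map c v))
      = (\<Sum>j\<in>UNIV. \<Sum>v | length v = n. (Q i j * c j) * (tensor_coeff Q w' v * prod_list (map c v)))"
    unfolding sum_lists_Suc by (simp add: w tensor_coeff_def mult_ac)
  also have "\<dots> = (\<Sum>j\<in>UNIV. Q i j * c j) * prod_list (map (\<lambda>i. \<Sum>j\<in>UNIV. Q i j * c j) w')"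
    by (simp add: sum_distrib_right Suc.IH w flip: sum_distrib_left)
  finally show ?case by (simp add: w)
qed

text \<open>The norm of a pure tensor is the product of the norms of its factors. In this way tensor
  components produce the powers \<open>t ^ n\<close> of the weight.\<close>

lemma sum_monomial_squares:
  fixes c :: "'i::finite \<Rightarrow> real"
  shows "(\<Sum>v | length v = n. (prod_list (map c v))\<^sup>2) = (\<Sum>i\<in>UNIV. (c i)\<^sup>2) ^ n"
proof (induction n)
  case (Suc n)
  then show ?case
    unfolding sum_lists_Suc
    by (simp add: power_mult_distrib sum_distrib_right flip: sum_distrib_left)
qed simp

section \<open>Lebesgue measure under translations and invertible linear maps\<close>

lemma nn_integral_lborel_translate:
  fixes f :: "'a::euclidean_space \<Rightarrow> ennreal"
  assumes [measurable]: "f \<in> borel_measurable borel"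
  shows "(\<integral>\<^sup>+x. f (c + x) \<partial>lborel) = (\<integral>\<^sup>+x. f x \<partial>lborel)"
proof -
  have "(\<integral>\<^sup>+x. f x \<partial>lborel) = (\<integral>\<^sup>+x. f x \<partial>distr lborel borel ((+) c))"
    by (simp add: lborel_distr_plus)
  also have "\<dots> = (\<integral>\<^sup>+x. f (c + x) \<partial>lborel)"
    by (rule nn_integral_distr) measurable
  finally show ?thesis ..
qed

text \<open>Haar uniqueness argument: for every \<open>g\<close> of integral 1, translation invariance and Fubini
  turn \<open>\<integral>f(Ax) dx = \<integral>\<integral>f(Ax + y) g(y) dx dy\<close> into \<open>\<integral>f(y) dy\<close> times the constant \<open>\<integral>g(-Ax) dx\<close>.
  The library's change of variables theorems for linear maps need a well-ordered index type.\<close>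
lemma nn_integral_lborel_linear:
  fixes A :: "'a::euclidean_space \<Rightarrow> 'a"
  assumes A: "linear A" and bij: "bij A"
  shows "\<exists>d>0. \<forall>f\<in>borel_measurable borel.
    (\<integral>\<^sup>+x. f (A x) \<partial>lborel) = ennreal d * (\<integral>\<^sup>+x. f x \<partial>lborel)"
proof -
  define B where "B = inv A"
  have B: "linear B" unfolding B_def using A bij by (metis bij_is_inj inj_linear_imp_inv_linear)
  have AB: "A (B x) = x" "B (A x) = x" for x
    unfolding B_def using bij by (simp_all add: bij_is_surj surj_f_inv_f bij_is_inj)
  have [measurable]: "A \<in> borel_measurable borel"
    using A by (simp add: borel_measurable_continuous_onI linear_continuous_on linear_conv_bounded_linear)
  \<comment> \<open>The unit cube has measure 1, which normalises \<open>g\<close>; its boundedness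
    will make \<open>c\<close> finite.\<close>
  define Q where "Q = box (0::'a) One"
  define g :: "'a \<Rightarrow> ennreal" where "g = indicator Q"
  have [measurable]: "g \<in> borel_measurable borel" unfolding g_def Q_def by measurable
  have g1: "(\<integral>\<^sup>+y. g y \<partial>lborel) = 1"
    unfolding g_def Q_def by (simp add: emeasure_lborel_box)
  define c where "c = (\<integral>\<^sup>+x. g (- A x) \<partial>lborel)"
  have main: "(\<integral>\<^sup>+x. f (A x) \<partial>lborel) = c * (\<integral>\<^sup>+x. f x \<partial>lborel)"
    if [measurable]: "f \<in> borel_measurable borel" for f
  proof -
    have "(\<integral>\<^sup>+x. f (A x) \<partial>lborel) = (\<integral>\<^sup>+y. g y * (\<integral>\<^sup>+x. f (A x) \<partial>lborel) \<partial>lborel)"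
      by (simp add: nn_integral_multc g1)
    also have "\<dots> = (\<integral>\<^sup>+y. g y * (\<integral>\<^sup>+x. f (A x + y) \<partial>lborel) \<partial>lborel)"
    proof (rule nn_integral_cong, rule arg_cong2[where f = "(*)", OF refl])
      fix y
      \<comment> \<open>The shift by \<open>y\<close> in the argument of \<open>f\<close> is a
        translation of \<open>x\<close> by \<open>B y\<close>, which the integral ignores.\<close>
      have "A (B y + x) = A x + y" for x by (simp add: linear_add[OF A] AB)
      then show "(\<integral>\<^sup>+x. f (A x) \<partial>lborel) = (\<integral>\<^sup>+x. f (A x + y) \<partial>lborel)"
        using nn_integral_lborel_translate[of "\<lambda>x. f (A x)" "B y"] by simp
    qed
    also have "\<dots> = (\<integral>\<^sup>+y. \<integral>\<^sup>+x. g y * f (A x + y) \<partial>lborel \<partial>lborel)"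
      by (simp add: nn_integral_cmult)
    also have "\<dots> = (\<integral>\<^sup>+x. \<integral>\<^sup>+y. g y * f (A x + y) \<partial>lborel \<partial>lborel)"
      by (rule lborel_pair.Fubini') measurable
    also have "\<dots> = (\<integral>\<^sup>+x. \<integral>\<^sup>+y. g (y - A x) * f y \<partial>lborel \<partial>lborel)"
    proof (rule nn_integral_cong)
      fix x
      show "(\<integral>\<^sup>+y. g y * f (A x + y) \<partial>lborel) = (\<integral>\<^sup>+y. g (y - A x) * f y \<partial>lborel)"
        using nn_integral_lborel_translate[of "\<lambda>y. g (y - A x) * f y" "A x"] by simp
    qed
    also have "\<dots> = (\<integral>\<^sup>+y. \<integral>\<^sup>+x. g (y - A x) * f y \<partial>lborel \<partial>lborel)"
      by (rule lborel_pair.Fubini') measurable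
    also have "\<dots> = (\<integral>\<^sup>+y. (\<integral>\<^sup>+x. g (y - A x) \<partial>lborel) * f y \<partial>lborel)"
      by (simp add: nn_integral_multc)
    also have "\<dots> = (\<integral>\<^sup>+y. c * f y \<partial>lborel)"
    proof (rule nn_integral_cong, rule arg_cong2[where f = "(*)", OF _ refl])
      fix y
      have "y - A (B y + x) = - A x" for x by (simp add: linear_add[OF A] AB)
      then show "(\<integral>\<^sup>+x. g (y - A x) \<partial>lborel) = c"
        unfolding c_def using nn_integral_lborel_translate[of "\<lambda>x. g (y - A x)" "B y"] by simp
    qed
    also have "\<dots> = c * (\<integral>\<^sup>+y. f y \<partial>lborel)" by (rule nn_integral_cmult) measurable
    finally show ?thesis .
  qed
  \<comment> \<open>For \<open>f = 1\<close> the identity equates the infinite total mass with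
    \<open>c\<close> times itself.\<close>
  have "c \<noteq> 0"
    using main[of "\<lambda>_. 1"] by auto
  moreover have "c < \<infinity>"
  proof -
    \<comment> \<open>\<open>g (- A x)\<close> is nonzero only for \<open>x\<close> in the image of
      the cube under \<open>- B\<close>, a bounded set and hence one of finite measure.\<close>
    have "bounded ((\<lambda>y. - B y) ` Q)"
      unfolding Q_def using B
      by (intro bounded_linear_image[OF bounded_box] bounded_linear_minus)
        (simp add: linear_conv_bounded_linear)
    then obtain e where e: "(\<lambda>y. - B y) ` Q \<subseteq> ball 0 e" using bounded_subset_ballD by blast
    have "c \<le> (\<integral>\<^sup>+x. indicator (ball (0::'a) e) x \<partial>lborel)"
      unfolding c_def
    proof (rule nn_integral_mono)
      fix x
      have "x \<in> ball 0 e" if "- A x \<in> Q"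
        using subsetD[OF e imageI[OF that]] by (simp only: linear_neg[OF B] AB minus_minus)
      then show "g (- A x) \<le> indicator (ball 0 e) x" unfolding g_def by (auto simp: indicator_def)
    qed
    also have "\<dots> < \<infinity>" using emeasure_bounded_finite[OF bounded_ball] by simp
    finally show ?thesis .
  qed
  ultimately show ?thesis
    using main by (intro exI[of _ "enn2real c"]) (auto simp: enn2real_positive_iff less_top zero_less_iff_neq_zero)
qed

section \<open>Orthonormal bases and the matrix of the inverse\<close>

context
  fixes ip :: "real^'n \<Rightarrow> real^'n \<Rightarrow> real"
  assumes ip: "is_inner_product ip"
begin

lemma ip_commute: "ip x y = ip y x"
  using ip by (simp add: is_inner_product_def)

lemma linear_ip_left: "linear (\<lambda>x. ip x y)"
proof (rule linearI)
  show "ip (x + z) y = ip x y + ip z y" "ip (c *\<^sub>R x) y = c *\<^sub>R ip x y" for x z c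
    using ip unfolding is_inner_product_def real_scaleR_def by blast+
qed

lemma linear_ip_right: "linear (ip x)"
  using linear_ip_left[of x] by (subst (asm) ip_commute)

lemma ip_pos: "x \<noteq> 0 \<Longrightarrow> ip x x > 0"
  using ip by (simp add: is_inner_product_def)

lemma ip_eq_0: "ip x x = 0 \<Longrightarrow> x = 0"
  using ip_pos by force

text \<open>Gram-Schmidt for the given inner product: \<open>k < CARD('n)\<close> vectors do not
  span the space, and a vector outside their span, minus its projection and normalised, extends the
  family.\<close>

lemma ip_orthonormal_exists:
  "k \<le> CARD('n) \<Longrightarrow> \<exists>S. finite S \<and> card S = k \<and> (\<forall>x\<in>S. \<forall>y\<in>S. ip x y = (if x = y then 1 else 0))"
proof (induction k)
  case 0
  show ?case by (intro exI[of _ "{}"]) simp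
next
  case (Suc k)
  then obtain S where S: "finite S" "card S = k"
    and on: "\<And>x y. x \<in> S \<Longrightarrow> y \<in> S \<Longrightarrow> ip x y = (if x = y then 1 else 0)" by auto
  have "dim (span S) < CARD('n)"
    using dim_le_card'[OF S(1)] S(2) Suc.prems by simp
  then have "span S \<noteq> UNIV" using dim_UNIV by (metis less_irrefl DIM_cart DIM_real mult_1_right)
  then obtain x where x: "x \<notin> span S" by blast
  define y where "y = x - (\<Sum>s\<in>S. ip x s *\<^sub>R s)"
  have "(\<Sum>s\<in>S. ip x s *\<^sub>R s) \<in> span S" by (intro span_sum span_scale span_base)
  then have "y \<notin> span S" unfolding y_def using x span_add by fastforce
  then have y0: "y \<noteq> 0" using span_zero by blast
  have orth: "ip y t = 0" if "t \<in> S" for t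
  proof -
    have "ip y t = ip x t - (\<Sum>s\<in>S. ip x s * ip s t)"
      unfolding y_def by (simp add: linear_diff[OF linear_ip_left] linear_sum[OF linear_ip_left]
          linear_scale[OF linear_ip_left])
    also have "(\<Sum>s\<in>S. ip x s * ip s t) = (\<Sum>s\<in>S. if s = t then ip x t else 0)"
      by (rule sum.cong) (auto simp: on that)
    finally show ?thesis using S that by simp
  qed
  define e where "e = (1 / sqrt (ip y y)) *\<^sub>R y"
  have e1: "ip e e = 1"
    unfolding e_def using ip_pos[OF y0] by (simp add: linear_scale[OF linear_ip_left] linear_scale[OF linear_ip_right])
  have e0: "ip e t = 0" "ip t e = 0" if "t \<in> S" for t
    using orth[OF that] ip_commute[of t e] unfolding e_def
    by (simp_all add: linear_scale[OF linear_ip_left])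
  have "e \<notin> S" using e0 e1 by force
  then show ?case
    using S on e0 e1 by (intro exI[of _ "insert e S"]) auto
qed

lemma ip_orthonormal_basis:
  "\<exists>b :: 'n \<Rightarrow> real^'n. (\<forall>i j. ip (b i) (b j) = (if i = j then 1 else 0)) \<and>
    (\<forall>x. x = (\<Sum>i\<in>UNIV. ip x (b i) *\<^sub>R b i))"
proof -
  obtain S where S: "finite S" "card S = CARD('n)"
    and on: "\<And>x y. x \<in> S \<Longrightarrow> y \<in> S \<Longrightarrow> ip x y = (if x = y then 1 else 0)"
    using ip_orthonormal_exists[of "CARD('n)"] by auto
  obtain b where b: "bij_betw b (UNIV :: 'n set) S"
    using S finite_same_card_bij[of "UNIV :: 'n set" S] by auto
  have orth: "ip (b i) (b j) = (if i = j then 1 else 0)" for i j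
    using b on[of "b i" "b j"] by (auto simp: bij_betw_def inj_def)
  \<comment> \<open>Pairing with a member of \<open>S\<close> reads off its coefficient. This gives
    independence of \<open>S\<close>, hence by counting that it spans, and afterwards the
    coefficients of the expansion.\<close>
  have coord: "ip (\<Sum>s\<in>S. u s *\<^sub>R s) t = u t" if "t \<in> S" for u t
  proof -
    have "ip (\<Sum>s\<in>S. u s *\<^sub>R s) t = (\<Sum>s\<in>S. if s = t then u t else 0)"
      by (simp add: linear_sum[OF linear_ip_left] linear_scale[OF linear_ip_left])
        (rule sum.cong, auto simp: on that)
    then show ?thesis using S that by simp
  qed
  have "independent S"
  proof (rule independent_if_scalars_zero[OF S(1)])
    fix u t assume "(\<Sum>s\<in>S. u s *\<^sub>R s) = 0" "t \<in> S"
    then show "u t = 0" using coord[of t u] linear_0[OF linear_ip_left] by simp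
  qed
  then have "span S = UNIV"
    using card_ge_dim_independent[of S UNIV] S by (auto simp: dim_UNIV)
  then have "x = (\<Sum>i\<in>UNIV. ip x (b i) *\<^sub>R b i)" for x
  proof -
    have "x \<in> span S" using \<open>span S = UNIV\<close> by simp
    then obtain u where u: "x = (\<Sum>s\<in>S. u s *\<^sub>R s)"
      using span_finite[OF S(1)] by auto
    have "(\<Sum>s\<in>S. u s *\<^sub>R s) = (\<Sum>s\<in>S. ip x s *\<^sub>R s)"
      unfolding u by (intro sum.cong refl) (simp add: coord)
    with u have "x = (\<Sum>s\<in>S. ip x s *\<^sub>R s)" by (rule trans)
    also have "\<dots> = (\<Sum>i\<in>UNIV. ip x (b i) *\<^sub>R b i)"
      using sum.reindex_bij_betw[OF b, of "\<lambda>s. ip x s *\<^sub>R s"] by simp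
    finally show ?thesis .
  qed
  then show ?thesis using orth by (intro exI[of _ b] conjI allI)
qed

lemma ip_expand:
  assumes x: "\<And>x. x = (\<Sum>i\<in>UNIV. ip x (b i) *\<^sub>R b i)"
  shows "ip x y = (\<Sum>i\<in>(UNIV :: 'n set). ip x (b i) * ip y (b i))"
proof -
  have "ip x y = ip x (\<Sum>i\<in>UNIV. ip y (b i) *\<^sub>R b i)" by (subst x[symmetric]) (rule refl)
  also have "\<dots> = (\<Sum>i\<in>UNIV. ip x (b i) * ip y (b i))"
    by (simp add: linear_sum[OF linear_ip_right] linear_scale[OF linear_ip_right] mult.commute)
  finally show ?thesis .
qed

text \<open>The adjoint of \<open>inv A\<close> is the inverse of \<open>As\<close>, and inverses of
  commuting maps commute, so \<open>inv A\<close> is normal as well; \<open>Q\<close> is its matrix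
  in the basis \<open>b\<close>. The second claim is what lets tensor powers of \<open>Q\<close>
  undo \<open>A\<close> on pure tensors.\<close>

lemma normal_inverse_matrix:
  fixes b :: "'n \<Rightarrow> real^'n"
  assumes b: "\<And>x. x = (\<Sum>i\<in>UNIV. ip x (b i) *\<^sub>R b i)"
    and A: "linear A" "bij A"
    and As: "linear As" "\<And>x y. ip (A x) y = ip x (As y)" "A \<circ> As = As \<circ> A"
  defines "Q \<equiv> \<lambda>i j. ip (inv A (b j)) (b i)"
  shows "(\<Sum>j\<in>UNIV. Q i j * Q k j) = (\<Sum>j\<in>UNIV. Q j i * Q j k)"
    and "(\<Sum>j\<in>UNIV. Q i j * ip (A x) (b j)) = ip x (b i)"
proof -
  have lB: "linear (inv A)" using A by (metis bij_is_inj inj_linear_imp_inv_linear)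
  have AB: "A (inv A x) = x" "inv A (A x) = x" for x
    using A(2) by (simp_all add: bij_is_surj surj_f_inv_f bij_is_inj)
  \<comment> \<open>If \<open>As x = 0\<close>, then \<open>x = A (inv A x)\<close> is orthogonal to
    itself.\<close>
  have "inj As"
  proof (rule linear_injective_0[OF As(1), THEN iffD2], intro allI impI)
    fix x assume "As x = 0"
    then have "ip (A (inv A x)) x = 0" by (simp only: As(2) linear_0[OF linear_ip_right])
    then show "x = 0" by (simp add: AB ip_eq_0)
  qed
  then have "bij As" using As(1) linear_injective_imp_surjective by (auto simp: bij_def)
  then have AsB: "As (inv As x) = x" "inv As (As x) = x" for x
    by (simp_all add: bij_is_surj surj_f_inv_f bij_is_inj)
  have adjB: "ip (inv A x) y = ip x (inv As y)" for x y
    using As(2)[of "inv A x" "inv As y"] by (simp add: AB AsB)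
  have adjB': "ip (inv As x) y = ip x (inv A y)" for x y
    using adjB[of y x] ip_commute[of y "inv As x"] ip_commute[of "inv A y" x] by argo
  have comm: "A (As x) = As (A x)" for x using As(3) by (metis comp_apply)
  have commB: "inv A (inv As x) = inv As (inv A x)" for x
  proof -
    have "A (As (inv A (inv As x))) = x" by (simp add: comm AB AsB)
    then have "As (inv A (inv As x)) = inv A x" using AB(2) by metis
    then show ?thesis using AsB(2) by metis
  qed
  \<comment> \<open>Row \<open>i\<close> of \<open>Q\<close> holds the coordinates of
    \<open>inv As (b i)\<close> and column \<open>i\<close> those of \<open>inv A (b i)\<close>, so
    both sums are inner products by Parseval.\<close>
  have "(\<Sum>j\<in>UNIV. Q i j * Q k j) = ip (inv As (b i)) (inv As (b k))"
    unfolding Q_def adjB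
    by (rule trans[OF _ ip_expand[OF b, symmetric]], intro sum.cong refl arg_cong2[where f = "(*)"]
        ip_commute)
  also have "\<dots> = ip (inv A (b i)) (inv A (b k))"
    unfolding adjB adjB' by (simp only: commB)
  also have "\<dots> = (\<Sum>j\<in>UNIV. Q j i * Q j k)"
    unfolding Q_def by (rule ip_expand[OF b])
  finally show "(\<Sum>j\<in>UNIV. Q i j * Q k j) = (\<Sum>j\<in>UNIV. Q j i * Q j k)" .
  have "ip x (b i) = ip (inv A (\<Sum>j\<in>UNIV. ip (A x) (b j) *\<^sub>R b j)) (b i)"
    by (subst b[symmetric]) (simp add: AB)
  also have "\<dots> = (\<Sum>j\<in>UNIV. Q i j * ip (A x) (b j))"
    unfolding Q_def by (simp add: linear_sum[OF lB] linear_scale[OF lB] linear_sum[OF linear_ip_left]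
        linear_scale[OF linear_ip_left] mult.commute)
  finally show "(\<Sum>j\<in>UNIV. Q i j * ip (A x) (b j)) = ip x (b i)" by simp
qed

end

section \<open>Tensor fields on Euclidean space\<close>

definition lists_lborel :: "('i::finite list \<times> 'a::euclidean_space) measure" where
  "lists_lborel = count_space UNIV \<Otimes>\<^sub>M lborel"

lemma space_lists_lborel [simp]: "space lists_lborel = UNIV"
  by (simp add: lists_lborel_def space_pair_measure)

lemma measurable_lists_lborel:
  "F \<in> borel_measurable lists_lborel \<longleftrightarrow> (\<forall>w. (\<lambda>x. F (w, x)) \<in> borel_measurable borel)"
proof
  assume "F \<in> borel_measurable lists_lborel"
  then show "\<forall>w. (\<lambda>x. F (w, x)) \<in> borel_measurable borel"
    using measurable_Pair2[of F "count_space UNIV" lborel borel] by (simp add: lists_lborel_def)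
next
  assume "\<forall>w. (\<lambda>x. F (w, x)) \<in> borel_measurable borel"
  then show "F \<in> borel_measurable lists_lborel"
    unfolding lists_lborel_def by (intro measurable_pair_measure_countable1) simp_all
qed

lemma finite_lists_length [simp]: "finite {v::'i::finite list. length v = n}"
  using finite_lists_length_eq[of "UNIV :: 'i set" n] by simp

lemma finite_lists_length_less [simp]: "finite {v::'i::finite list. length v < n}"
proof -
  have "{v::'i list. length v < n} = (\<Union>k<n. {v. length v = k})" by auto
  then show ?thesis by simp
qed

lemma nn_integral_lists_lborel:
  assumes "F \<in> borel_measurable lists_lborel"
  shows "(\<integral>\<^sup>+z. F z \<partial>lists_lborel) = (\<integral>\<^sup>+w. \<integral>\<^sup>+x. F (w, x) \<partial>lborel \<partial>count_space UNIV)"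
  using sigma_finite_measure.nn_integral_fst[OF sigma_finite_lborel assms[unfolded lists_lborel_def]]
  unfolding lists_lborel_def by simp

lemma nn_integral_lists_lborel':
  assumes "F \<in> borel_measurable lists_lborel"
  shows "(\<integral>\<^sup>+z. F z \<partial>lists_lborel) = (\<integral>\<^sup>+x. \<integral>\<^sup>+w. F (w, x) \<partial>count_space UNIV \<partial>lborel)"
proof -
  interpret pair_sigma_finite "count_space (UNIV :: 'a list set)" "lborel :: 'b measure"
    by (intro pair_sigma_finite.intro sigma_finite_measure_count_space_countable sigma_finite_lborel)
       simp
  show ?thesis
    using nn_integral_snd[of F] assms unfolding lists_lborel_def by simp
qed

text \<open>Each list has mass 1, so the integral of a single component is bounded by the whole
  integral, without exceptional lists.\<close>

lemma L2set_section:
  assumes F: "F \<in> L2set lists_lborel"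
  shows "(\<lambda>x. F (w, x)) \<in> L2set lborel"
proof -
  have m [measurable]: "(\<lambda>x. F (w, x)) \<in> borel_measurable borel" for w
    using L2setD[OF F] unfolding measurable_lists_lborel by (rule spec)
  have "(\<integral>\<^sup>+x. ennreal ((cmod (F (w, x)))\<^sup>2) \<partial>lborel)
      \<le> (\<integral>\<^sup>+w. \<integral>\<^sup>+x. ennreal ((cmod (F (w, x)))\<^sup>2) \<partial>lborel \<partial>count_space UNIV)"
    by (rule nn_integral_ge_point) simp
  also have "\<dots> = (\<integral>\<^sup>+z. ennreal ((cmod (F z))\<^sup>2) \<partial>lists_lborel)"
    using L2setD[OF F] by (subst nn_integral_lists_lborel) auto
  also have "\<dots> < \<infinity>" using F by (simp add: L2set_iff)
  finally show ?thesis by (simp add: L2set_iff)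
qed

lemma L2set_lists_finite_support:
  assumes W: "finite W" "\<And>w x. w \<notin> W \<Longrightarrow> F (w, x) = 0"
    and F: "\<And>w. (\<lambda>x. F (w, x)) \<in> L2set lborel"
  shows "F \<in> L2set lists_lborel"
proof -
  have m [measurable]: "F \<in> borel_measurable lists_lborel"
    unfolding measurable_lists_lborel using L2setD[OF F] by simp
  have "(\<integral>\<^sup>+z. ennreal ((cmod (F z))\<^sup>2) \<partial>lists_lborel)
      = (\<integral>\<^sup>+w. \<integral>\<^sup>+x. ennreal ((cmod (F (w, x)))\<^sup>2) \<partial>lborel \<partial>count_space UNIV)"
    by (rule nn_integral_lists_lborel) measurable
  also have "\<dots> = (\<Sum>w\<in>W. \<integral>\<^sup>+x. ennreal ((cmod (F (w, x)))\<^sup>2) \<partial>lborel)"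
    by (rule nn_integral_count_space') (auto simp: W)
  also have "\<dots> < \<infinity>" using F W(1) by (auto simp: L2set_iff ennreal_sum_less_top)
  finally show ?thesis by (simp add: L2set_iff m)
qed

text \<open>Fubini turns the inner product into a sum over lists, of which only those in
  \<open>W\<close> contribute; for truncated fields adjointness thereby becomes finite algebra over
  the components.\<close>

lemma l2ip_lists_finite_support:
  assumes W: "finite W" "\<And>w x. w \<notin> W \<Longrightarrow> F (w, x) * cnj (G (w, x)) = 0"
    and F: "F \<in> L2set lists_lborel" and G: "G \<in> L2set lists_lborel"
  shows "l2ip lists_lborel F G = (\<Sum>w\<in>W. l2ip lborel (\<lambda>x. F (w, x)) (\<lambda>x. G (w, x)))"
proof -
  interpret pair_sigma_finite "count_space (UNIV :: 'a list set)" "lborel :: 'b measure"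
    by (intro pair_sigma_finite.intro sigma_finite_measure_count_space_countable sigma_finite_lborel)
       simp
  have z: "l2ip lborel (\<lambda>x. F (w, x)) (\<lambda>x. G (w, x)) = 0" if "w \<notin> W" for w
    unfolding l2ip_def W(2)[OF that] by simp
  have "l2ip lists_lborel F G
      = (\<integral>w. l2ip lborel (\<lambda>x. F (w, x)) (\<lambda>x. G (w, x)) \<partial>count_space UNIV)"
    using L2set_prod_integrable[OF F G] unfolding l2ip_def lists_lborel_def
    by (subst integral_fst'[symmetric]) simp_all
  also have "\<dots> = (\<Sum>w | l2ip lborel (\<lambda>x. F (w, x)) (\<lambda>x. G (w, x)) \<noteq> 0.
      l2ip lborel (\<lambda>x. F (w, x)) (\<lambda>x. G (w, x)))"
  proof -
    have "{w. l2ip lborel (\<lambda>x. F (w, x)) (\<lambda>x. G (w, x)) \<noteq> 0} \<subseteq> W"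
      using z by blast
    then have "finite {w. l2ip lborel (\<lambda>x. F (w, x)) (\<lambda>x. G (w, x)) \<noteq> 0}"
      using W(1) finite_subset by blast
    then show ?thesis by (subst lebesgue_integral_count_space_finite_support) simp_all
  qed
  also have "\<dots> = (\<Sum>w\<in>W. l2ip lborel (\<lambda>x. F (w, x)) (\<lambda>x. G (w, x)))"
    using W(1) z by (intro sum.mono_neutral_left) auto
  finally show ?thesis .
qed

text \<open>Abstracts \<open>A\<close> to an invertible Borel map with constant Jacobian and the
  matrix of its inverse to a normal matrix \<open>Q\<close>; the two are linked in
  \<open>T_tensor_embedding\<close>. In the application \<open>d\<close> is the reciprocal of
  \<open>|det A|\<close>.\<close>

locale tensor_pullback =
  fixes A B :: "'a::euclidean_space \<Rightarrow> 'a" and d :: real and Q :: "'i::finite \<Rightarrow> 'i \<Rightarrow> real"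
  assumes A_meas [measurable]: "A \<in> borel_measurable borel"
    and B_meas [measurable]: "B \<in> borel_measurable borel"
    and AB [simp]: "A (B x) = x" and BA [simp]: "B (A x) = x" and d_pos: "d > 0"
    and pullback: "h \<in> borel_measurable borel \<Longrightarrow>
      (\<integral>\<^sup>+x. h (A x) \<partial>lborel) = ennreal d * (\<integral>\<^sup>+x. h x \<partial>lborel)"
    and Q_normal: "(\<Sum>j\<in>UNIV. Q i j * Q k j) = (\<Sum>j\<in>UNIV. Q j i * Q j k)"
begin

lemma L2set_comp_A:
  assumes f: "f \<in> L2set lborel" shows "(\<lambda>x. f (A x)) \<in> L2set lborel"
proof -
  have [measurable]: "f \<in> borel_measurable borel" using L2setD[OF f] by simp
  have "(\<integral>\<^sup>+x. ennreal ((cmod (f (A x)))\<^sup>2) \<partial>lborel) < \<infinity>"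
    using f by (subst pullback) (auto simp: L2set_iff ennreal_mult_less_top)
  then show ?thesis by (simp add: L2set_iff)
qed

lemma L2set_comp_B:
  assumes f: "f \<in> L2set lborel" shows "(\<lambda>x. f (B x)) \<in> L2set lborel"
proof -
  have [measurable]: "f \<in> borel_measurable borel" using L2setD[OF f] by simp
  have "ennreal d * (\<integral>\<^sup>+x. ennreal ((cmod (f (B x)))\<^sup>2) \<partial>lborel)
      = (\<integral>\<^sup>+x. ennreal ((cmod (f x))\<^sup>2) \<partial>lborel)"
    by (subst pullback[symmetric]) auto
  then have "ennreal d * (\<integral>\<^sup>+x. ennreal ((cmod (f (B x)))\<^sup>2) \<partial>lborel) < \<infinity>"
    using f by (simp add: L2set_iff)
  then have "(\<integral>\<^sup>+x. ennreal ((cmod (f (B x)))\<^sup>2) \<partial>lborel) < \<infinity>"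
    using d_pos by (auto simp: ennreal_mult_less_top)
  then show ?thesis by (simp add: L2set_iff)
qed

text \<open>Stated for the image measure, the scaling rule extends from nonnegative to complex
  integrands.\<close>

lemma distr_A: "distr lborel borel A = density lborel (\<lambda>_. ennreal d)"
proof (rule measure_eqI)
  fix X assume "X \<in> sets (distr lborel borel A)"
  then have [measurable]: "X \<in> sets borel" by simp
  have "emeasure (distr lborel borel A) X = (\<integral>\<^sup>+x. indicator X x \<partial>distr lborel borel A)" by simp
  also have "\<dots> = (\<integral>\<^sup>+x. indicator X (A x) \<partial>lborel)"
    by (rule nn_integral_distr) measurable
  also have "\<dots> = emeasure (density lborel (\<lambda>_. ennreal d)) X"
    by (subst pullback) (simp_all add: emeasure_density nn_integral_cmult)
  finally show "emeasure (distr lborel borel A) X = emeasure (density lborel (\<lambda>_. ennreal d)) X" .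
qed simp

text \<open>The substitution \<open>y = A x\<close> shows that composition with \<open>A\<close> has
  as its adjoint \<open>d\<close> times composition with \<open>B\<close>.\<close>

lemma l2ip_comp:
  assumes f: "f \<in> L2set lborel" and g: "g \<in> L2set lborel"
  shows "l2ip lborel (\<lambda>x. f (A x)) g = d * l2ip lborel f (\<lambda>x. g (B x))"
proof -
  have [measurable]: "f \<in> borel_measurable borel" "g \<in> borel_measurable borel"
    using L2setD[OF f] L2setD[OF g] by simp_all
  have "l2ip lborel (\<lambda>x. f (A x)) g = (\<integral>x. f (A x) * cnj (g (B (A x))) \<partial>lborel)"
    by (simp add: l2ip_def)
  also have "\<dots> = (\<integral>y. f y * cnj (g (B y)) \<partial>distr lborel borel A)"
    by (rule integral_distr[symmetric]) measurable
  also have "\<dots> = d * l2ip lborel f (\<lambda>x. g (B x))"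
    unfolding distr_A l2ip_def using d_pos by (subst integral_density) (auto simp: scaleR_conv_of_real)
  finally show ?thesis .
qed

section \<open>The operator on tensor fields and its formal adjoint\<close>

definition T :: "('i list \<times> 'a \<Rightarrow> complex) \<Rightarrow> 'i list \<times> 'a \<Rightarrow> complex" where
  "T F = (\<lambda>(w, x). \<Sum>v | length v = length w. complex_of_real (tensor_coeff Q w v) * F (v, A x))"

text \<open>The formal adjoint of \<open>T\<close>: the Kronecker power is transposed,
  \<open>B\<close> replaces \<open>A\<close>, and \<open>d\<close> comes from the
  substitution.\<close>

definition S :: "('i list \<times> 'a \<Rightarrow> complex) \<Rightarrow> 'i list \<times> 'a \<Rightarrow> complex" where
  "S F = (\<lambda>(v, y). \<Sum>w | length w = length v. complex_of_real (d * tensor_coeff Q w v) * F (w, B y))"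

text \<open>The substitutions by \<open>A\<close> and \<open>B\<close> cancel. What remains is
  \<open>d\<close> times the Kronecker power of \<open>Q Q^T\<close> on one side and of
  \<open>Q^T Q\<close> on the other, and \<open>Q_normal\<close> equates them.\<close>

lemma T_S_comm: "T (S F) = S (T F)"
proof (rule ext, clarify)
  fix w :: "'i list" and x
  define n where "n = length w"
  have normal: "(\<Sum>v | length v = n. tensor_coeff Q w v * tensor_coeff Q u v)
      = (\<Sum>v | length v = n. tensor_coeff Q v w * tensor_coeff Q v u)" if "length u = n" for u
  proof -
    have "(\<Sum>v | length v = n. tensor_coeff Q w v * tensor_coeff Q u v)
      = tensor_coeff (\<lambda>i k. \<Sum>j\<in>UNIV. Q i j * Q k j) w u"
      using tensor_coeff_comp[of w n u Q "\<lambda>i j. Q j i"] that n_def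
      by (simp add: tensor_coeff_transpose[of Q u])
    also have "\<dots> = tensor_coeff (\<lambda>i k. \<Sum>j\<in>UNIV. Q j i * Q j k) w u"
      by (simp only: Q_normal)
    also have "\<dots> = (\<Sum>v | length v = n. tensor_coeff Q v w * tensor_coeff Q v u)"
      using tensor_coeff_comp[of w n u "\<lambda>i j. Q j i" Q] that n_def
      by (simp add: tensor_coeff_transpose[of Q _ w])
    finally show ?thesis .
  qed
  have "T (S F) (w, x) = (\<Sum>v | length v = n. \<Sum>u | length u = n.
      complex_of_real d * F (u, x) * complex_of_real (tensor_coeff Q w v * tensor_coeff Q u v))"
    unfolding T_def S_def by (auto simp: n_def sum_distrib_left mult_ac intro!: sum.cong)
  also have "\<dots> = (\<Sum>u | length u = n. \<Sum>v | length v = n.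
      complex_of_real d * F (u, x) * complex_of_real (tensor_coeff Q w v * tensor_coeff Q u v))"
    by (rule sum.swap)
  also have "\<dots> = (\<Sum>u | length u = n. complex_of_real d * F (u, x) *
      complex_of_real (\<Sum>v | length v = n. tensor_coeff Q w v * tensor_coeff Q u v))"
    by (simp add: sum_distrib_left)
  also have "\<dots> = (\<Sum>u | length u = n. complex_of_real d * F (u, x) *
      complex_of_real (\<Sum>v | length v = n. tensor_coeff Q v w * tensor_coeff Q v u))"
    by (intro sum.cong refl) (simp only: normal mem_Collect_eq)
  also have "\<dots> = (\<Sum>u | length u = n. \<Sum>v | length v = n.
      complex_of_real d * F (u, x) * complex_of_real (tensor_coeff Q v w * tensor_coeff Q v u))"
    by (simp add: sum_distrib_left)
  also have "\<dots> = (\<Sum>v | length v = n. \<Sum>u | length u = n.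
      complex_of_real d * F (u, x) * complex_of_real (tensor_coeff Q v w * tensor_coeff Q v u))"
    by (rule sum.swap)
  also have "\<dots> = S (T F) (w, x)"
    unfolding T_def S_def by (auto simp: n_def sum_distrib_left mult_ac intro!: sum.cong)
  finally show "T (S F) (w, x) = S (T F) (w, x)" .
qed

text \<open>The tensor degrees below \<open>n\<close>. They comprise finitely many lists, and
  \<open>T\<close> and \<open>S\<close> preserve the degree, so truncation commutes with
  both.\<close>

definition E :: "nat \<Rightarrow> ('i list \<times> 'a) set" where
  "E n = {w. length w < n} \<times> UNIV"

lemma T_cut: "T (\<lambda>z. indicator (E n) z * F z) = (\<lambda>z. indicator (E n) z * T F z)"
  by (auto simp: T_def E_def indicator_def sum_distrib_left fun_eq_iff intro!: sum.cong)

lemma S_cut: "S (\<lambda>z. indicator (E n) z * F z) = (\<lambda>z. indicator (E n) z * S F z)"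
  by (auto simp: S_def E_def indicator_def sum_distrib_left fun_eq_iff intro!: sum.cong)

lemma T_section_L2: "F \<in> L2set lists_lborel \<Longrightarrow> (\<lambda>x. T F (w, x)) \<in> L2set lborel"
  unfolding T_def split_conv by (intro L2set_sum L2set_scale L2set_comp_A L2set_section)

lemma S_section_L2: "F \<in> L2set lists_lborel \<Longrightarrow> (\<lambda>x. S F (w, x)) \<in> L2set lborel"
  unfolding S_def split_conv by (intro L2set_sum L2set_scale L2set_comp_B L2set_section)

lemma cut_L2:
  assumes "\<And>w. (\<lambda>x. F (w, x)) \<in> L2set lborel"
  shows "(\<lambda>z. indicator (E n) z * F z) \<in> L2set lists_lborel"
proof (rule L2set_lists_finite_support)
  show "finite {w::'i list. length w < n}" by simp
  show "(\<lambda>x. indicator (E n) (w, x) * F (w, x)) \<in> L2set lborel" for w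
    using L2set_scale[OF assms, of "indicator {w. length w < n} w" w]
    by (simp add: E_def indicator_def)
qed (auto simp: E_def indicator_def)

lemma adjoint_cut:
  assumes F: "F \<in> L2set lists_lborel" and G: "G \<in> L2set lists_lborel"
  shows "l2ip lists_lborel (\<lambda>z. indicator (E n) z * T F z) G
    = l2ip lists_lborel F (\<lambda>z. indicator (E n) z * S G z)"
proof -
  let ?W = "{w::'i list. length w < n}"
  note secF = L2set_section[OF F] and secG = L2set_section[OF G]
  have "l2ip lists_lborel (\<lambda>z. indicator (E n) z * T F z) G
      = (\<Sum>w\<in>?W. l2ip lborel (\<lambda>x. indicator (E n) (w, x) * T F (w, x)) (\<lambda>x. G (w, x)))"
    by (rule l2ip_lists_finite_support[OF _ _ cut_L2[OF T_section_L2[OF F]] G]) (auto simp: E_def)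
  also have "\<dots> = (\<Sum>w\<in>?W. l2ip lborel (\<lambda>x. T F (w, x)) (\<lambda>x. G (w, x)))"
    by (intro sum.cong refl) (simp add: E_def)
  also have "\<dots> = (\<Sum>w\<in>?W. \<Sum>v | length v = length w.
      complex_of_real (d * tensor_coeff Q w v) * l2ip lborel (\<lambda>x. F (v, x)) (\<lambda>x. G (w, B x)))"
    unfolding T_def split_conv
    by (rule sum.cong[OF refl], subst l2ip_sum_left)
       (auto intro!: L2set_scale L2set_comp_A secF secG sum.cong
         simp: l2ip_scale_left l2ip_comp[OF secF secG])
  \<comment> \<open>The added restriction \<open>v \<in> ?W\<close> is automatic, as
    \<open>v\<close> has the length of \<open>w\<close>; it prepares the exchange of the two
    sums.\<close>
  also have "\<dots> = (\<Sum>w\<in>?W. \<Sum>v | v \<in> ?W \<and> length v = length w.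
      complex_of_real (d * tensor_coeff Q w v) * l2ip lborel (\<lambda>x. F (v, x)) (\<lambda>x. G (w, B x)))"
    by (rule sum.cong) (auto intro!: sum.cong)
  also have "\<dots> = (\<Sum>v\<in>?W. \<Sum>w | w \<in> ?W \<and> length v = length w.
      complex_of_real (d * tensor_coeff Q w v) * l2ip lborel (\<lambda>x. F (v, x)) (\<lambda>x. G (w, B x)))"
    by (rule sum.swap_restrict) auto
  also have "\<dots> = (\<Sum>v\<in>?W. \<Sum>w | length w = length v.
      complex_of_real (d * tensor_coeff Q w v) * l2ip lborel (\<lambda>x. F (v, x)) (\<lambda>x. G (w, B x)))"
    by (rule sum.cong) (auto intro!: sum.cong)
  also have "\<dots> = (\<Sum>v\<in>?W. l2ip lborel (\<lambda>x. F (v, x)) (\<lambda>x. S G (v, x)))"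
    unfolding S_def split_conv
    by (rule sum.cong[OF refl], subst l2ip_sum_right)
       (auto intro!: L2set_scale L2set_comp_B secF secG sum.cong simp: l2ip_scale_right)
  also have "\<dots> = (\<Sum>v\<in>?W. l2ip lborel (\<lambda>x. F (v, x)) (\<lambda>x. indicator (E n) (v, x) * S G (v, x)))"
    by (intro sum.cong refl) (simp add: E_def)
  also have "\<dots> = l2ip lists_lborel F (\<lambda>z. indicator (E n) z * S G z)"
    by (rule l2ip_lists_finite_support[OF _ _ F cut_L2[OF S_section_L2[OF G]], symmetric])
       (auto simp: E_def)
  finally show ?thesis .
qed

lemma E_sets: "E n \<in> sets lists_lborel"
  unfolding E_def lists_lborel_def by (intro pair_measureI) auto

lemma T_meas: "F \<in> borel_measurable lists_lborel \<Longrightarrow> T F \<in> borel_measurable lists_lborel"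
  unfolding measurable_lists_lborel T_def split_conv
  by (intro allI borel_measurable_sum borel_measurable_times borel_measurable_const
      measurable_compose[OF A_meas]) simp

lemma S_meas: "F \<in> borel_measurable lists_lborel \<Longrightarrow> S F \<in> borel_measurable lists_lborel"
  unfolding measurable_lists_lborel S_def split_conv
  by (intro allI borel_measurable_sum borel_measurable_times borel_measurable_const
      measurable_compose[OF B_meas]) simp

lemma T_add: "T (\<lambda>z. F z + G z) = (\<lambda>z. T F z + T G z)"
  by (auto simp: T_def fun_eq_iff distrib_left sum.distrib)

lemma S_add: "S (\<lambda>z. F z + G z) = (\<lambda>z. S F z + S G z)"
  by (auto simp: S_def fun_eq_iff distrib_left sum.distrib)

lemma T_scale: "T (\<lambda>z. c * F z) = (\<lambda>z. c * T F z)"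
  by (auto simp: T_def fun_eq_iff sum_distrib_left mult_ac)

lemma S_scale: "S (\<lambda>z. c * F z) = (\<lambda>z. c * S F z)"
  by (auto simp: S_def fun_eq_iff sum_distrib_left mult_ac)

lemma exhausted_normal_pair:
  assumes "l2_model (lists_lborel :: ('i list \<times> 'a) measure) r"
  shows "exhausted_normal_pair (lists_lborel :: ('i list \<times> 'a) measure) r E T S"
proof -
  interpret l2_model "lists_lborel :: ('i list \<times> 'a) measure" r by fact
  show ?thesis
  proof unfold_locales
    show "incseq E" by (auto simp: incseq_def E_def)
    show "(\<Union>n. E n) = space lists_lborel" by (auto simp: E_def)
  qed (rule E_sets T_meas S_meas T_add S_add T_scale S_scale T_cut S_cut cut_L2[OF T_section_L2]
      cut_L2[OF S_section_L2] adjoint_cut T_S_comm | assumption)+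
qed

end

section \<open>Subnormality of the composition operator\<close>

text \<open>Cardinal arithmetic: an infinite set absorbs a countable factor. The surjection serves
  to encode functions on lists times points as functions of points alone.\<close>

lemma ex_surj_prod_countable:
  includes cardinal_syntax
  assumes "infinite (UNIV :: 'b set)"
  shows "\<exists>j :: 'b \<Rightarrow> 'c::countable \<times> 'b. surj j"
proof -
  obtain f :: "nat \<Rightarrow> 'b" where "inj f" using assms infinite_countable_subset by blast
  then have "inj (f \<circ> (to_nat :: 'c \<Rightarrow> nat))" by (intro inj_compose inj_to_nat) 
  then have le: "|UNIV :: 'c set| \<le>o |UNIV :: 'b set|"
    by (auto simp flip: card_of_ordLeq)
  have "|(UNIV :: 'c set) \<times> (UNIV :: 'b set)| =o |UNIV :: 'b set|"
    using card_of_Times_infinite[OF assms _ le] by (simp del: UNIV_Times_UNIV)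
  then obtain g :: "'b \<Rightarrow> 'c \<times> 'b" where "bij_betw g UNIV (UNIV \<times> UNIV)"
    using card_of_ordIso ordIso_symmetric by blast
  then show ?thesis by (auto simp: bij_betw_def)
qed

text \<open>A class is named by the set of its members, each transported along \<open>j\<close>. As
  \<open>j\<close> is surjective, \<open>h \<mapsto> h \<circ> j\<close> is injective, so the
  members can be recovered from the name.\<close>

lemma l2_model_image:
  assumes j: "surj j"
  shows "l2_model M (\<lambda>F. (\<lambda>h. h \<circ> j) ` {h \<in> L2set M. AE x in M. h x = F x})"
proof
  fix F G assume F: "F \<in> L2set M" and G: "G \<in> L2set M"
  let ?r = "\<lambda>F. (\<lambda>h. h \<circ> j) ` {h \<in> L2set M. AE x in M. h x = F x}"
  show "?r F = ?r G \<longleftrightarrow> (AE x in M. F x = G x)"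
  proof
    assume "?r F = ?r G"
    moreover have "F \<circ> j \<in> ?r F" using F by auto
    ultimately obtain h where "AE x in M. h x = G x" "F \<circ> j = h \<circ> j" by auto
    moreover from this have "F = h" using j by (metis comp_apply ext surjD)
    ultimately show "AE x in M. F x = G x" by simp
  next
    assume "AE x in M. F x = G x"
    then have "(AE x in M. h x = F x) \<longleftrightarrow> (AE x in M. h x = G x)" for h
      by (auto elim: eventually_elim2)
    then show "?r F = ?r G" by simp
  qed
qed

section \<open>The weighted space: density of the domain and the isometric embedding\<close>

lemma nn_integral_lists_by_length:
  fixes g :: "'i::finite list \<Rightarrow> ennreal"
  shows "(\<integral>\<^sup>+w. g w \<partial>count_space UNIV) = (\<Sum>n. \<Sum>w | length w = n. g w)"
proof -
  have "(\<Sum>n. if length w = n then g w else 0) = g w" for w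
    using suminf_finite[of "{length w}" "\<lambda>n. if length w = n then g w else 0"] by auto
  then have "(\<integral>\<^sup>+w. g w \<partial>count_space UNIV)
      = (\<integral>\<^sup>+w. (\<Sum>n. if length w = n then g w else 0) \<partial>count_space UNIV)" by simp
  also have "\<dots> = (\<Sum>n. \<integral>\<^sup>+w. (if length w = n then g w else 0) \<partial>count_space UNIV)"
    by (rule nn_integral_suminf) simp
  also have "\<dots> = (\<Sum>n. \<Sum>w | length w = n. g w)"
  proof (rule suminf_cong)
    fix n
    have "(\<integral>\<^sup>+w. (if length w = n then g w else 0) \<partial>count_space UNIV)
        = (\<Sum>w | length w = n. if length w = n then g w else 0)"
      by (rule nn_integral_count_space') auto
    then show "(\<integral>\<^sup>+w. (if length w = n then g w else 0) \<partial>count_space UNIV)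
        = (\<Sum>w | length w = n. g w)" by simp
  qed
  finally show ?thesis .
qed

lemma gamma_real_summable:
  assumes "\<forall>z::complex. summable (\<lambda>n. complex_of_real (a n) * z ^ n)"
  shows "summable (\<lambda>n. a n * t ^ n)"
  using assms[rule_format, of "complex_of_real t"] by (simp flip: of_real_power of_real_mult)

lemma gamma_real_measurable [measurable]: "gamma_real a \<in> borel_measurable borel"
  unfolding gamma_real_def by measurable

lemma L2set_density:
  fixes w :: "'a \<Rightarrow> real"
  assumes [measurable]: "w \<in> borel_measurable M" 
  shows "f \<in> L2set (density M (\<lambda>x. ennreal (w x))) \<longleftrightarrow> f \<in> borel_measurable M \<and>
    (\<integral>\<^sup>+x. ennreal (w x) * ennreal ((cmod (f x))\<^sup>2) \<partial>M) < \<infinity>"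
proof (cases "f \<in> borel_measurable M")
  case True
  note [measurable] = True
  show ?thesis unfolding L2set_iff by (simp add: nn_integral_density)
qed (simp add: L2set_iff)

text \<open>On \<open>E m\<close> the transported weight \<open>w (B y)\<close> is at most
  \<open>m\<close> times \<open>w y\<close>, so after the change of variables the cut-off of
  \<open>f\<close> to \<open>E m\<close> lies in the domain. A point with \<open>w x > 0\<close>
  belongs to all late \<open>E m\<close>, the other points form a null set of the weighted measure,
  and dominated convergence applies.\<close>

lemma dense_comp_dom:
  fixes A B :: "'a::euclidean_space \<Rightarrow> 'a" and w :: "'a \<Rightarrow> real"
  assumes [measurable]: "A \<in> borel_measurable borel" "B \<in> borel_measurable borel"
      "w \<in> borel_measurable borel"
    and BA: "\<And>x. B (A x) = x"
    and pullback: "\<And>h. h \<in> borel_measurable borel \<Longrightarrow>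
      (\<integral>\<^sup>+x. h (A x) \<partial>lborel) = ennreal d * (\<integral>\<^sup>+x. h x \<partial>lborel)"
    and f: "f \<in> L2set (density lborel (\<lambda>x. ennreal (w x)))" and e: "e > 0"
  shows "\<exists>g\<in>comp_dom (density lborel (\<lambda>x. ennreal (w x))) A.
    L2norm (density lborel (\<lambda>x. ennreal (w x))) (\<lambda>x. f x - g x) < e"
proof -
  let ?M = "density lborel (\<lambda>x. ennreal (w x))"
  define E where "E m = {y. w (B y) \<le> real m * w y}" for m :: nat
  have [measurable]: "E m \<in> sets borel" for m unfolding E_def by measurable
  have fm [measurable]: "f \<in> borel_measurable borel" using L2setD[OF f] by simp
  define g where "g m x = indicator (E m) x * f x" for m x
  have gm [measurable]: "g m \<in> borel_measurable borel" for m unfolding g_def by measurable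
  have g: "g m \<in> L2set ?M" for m
    unfolding g_def by (rule L2set_indicator[OF f]) simp
  have "(\<lambda>x. g m (A x)) \<in> L2set ?M" for m
  proof -
    have "(\<integral>\<^sup>+x. ennreal (w x) * ennreal ((cmod (g m (A x)))\<^sup>2) \<partial>lborel)
        = (\<integral>\<^sup>+x. ennreal (w (B (A x))) * ennreal ((cmod (g m (A x)))\<^sup>2) \<partial>lborel)"
      by (simp add: BA)
    also have "\<dots> = ennreal d * (\<integral>\<^sup>+y. ennreal (w (B y)) * ennreal ((cmod (g m y))\<^sup>2) \<partial>lborel)"
      by (rule pullback) measurable
    also have "\<dots> \<le> ennreal d * (\<integral>\<^sup>+y. ennreal (real m) * (ennreal (w y) * ennreal ((cmod (f y))\<^sup>2)) \<partial>lborel)"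
    proof (intro mult_left_mono nn_integral_mono)
      fix y
      show "ennreal (w (B y)) * ennreal ((cmod (g m y))\<^sup>2)
        \<le> ennreal (real m) * (ennreal (w y) * ennreal ((cmod (f y))\<^sup>2))"
      proof (cases "y \<in> E m")
        case True
        then have "ennreal (w (B y)) \<le> ennreal (real m) * ennreal (w y)"
          unfolding E_def by (simp add: ennreal_leI flip: ennreal_mult')
        then show ?thesis using True by (simp add: g_def mult_right_mono flip: mult.assoc)
      qed (simp add: g_def)
    qed simp
    also have "\<dots> = ennreal d * (ennreal (real m) *
        (\<integral>\<^sup>+y. ennreal (w y) * ennreal ((cmod (f y))\<^sup>2) \<partial>lborel))"
      by (simp add: nn_integral_cmult)
    also have "\<dots> < \<infinity>"
      using f by (simp add: L2set_density ennreal_mult_less_top)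
    finally show ?thesis by (simp add: L2set_density)
  qed
  then have dom: "g m \<in> comp_dom ?M A" for m
    using g by (simp add: comp_dom_def comp_def)
  have "(\<lambda>m. \<integral>x. (cmod (f x - g m x))\<^sup>2 \<partial>?M) \<longlonglongrightarrow> (\<integral>x. 0 \<partial>?M)"
  proof (rule integral_dominated_convergence)
    show "integrable ?M (\<lambda>x. (cmod (f x))\<^sup>2)" using f by (rule L2set_integrable)
    show "AE x in ?M. norm ((cmod (f x - g m x))\<^sup>2) \<le> (cmod (f x))\<^sup>2" for m
      by (auto simp: g_def indicator_def)
    have "AE x in ?M. w x > 0" by (subst AE_density) (auto simp: ennreal_eq_0_iff not_le)
    then show "AE x in ?M. (\<lambda>m. (cmod (f x - g m x))\<^sup>2) \<longlonglongrightarrow> 0"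
    proof eventually_elim
      fix x assume "w x > 0"
      obtain N where "w (B x) / w x \<le> real N" using real_arch_simple by blast
      then have "x \<in> E m" if "m \<ge> N" for m
      proof -
        have "w (B x) / w x \<le> real m" using that \<open>w (B x) / w x \<le> real N\<close> by linarith
        then show ?thesis using \<open>w x > 0\<close> by (simp add: E_def divide_le_eq)
      qed
      then have "\<forall>\<^sub>F m in sequentially. (cmod (f x - g m x))\<^sup>2 = 0"
        unfolding eventually_sequentially by (intro exI[of _ N]) (simp add: g_def)
      then show "(\<lambda>m. (cmod (f x - g m x))\<^sup>2) \<longlonglongrightarrow> 0" by (rule tendsto_eventually)
    qed
  qed measurable
  then have "(\<lambda>m. L2norm ?M (\<lambda>x. f x - g m x)) \<longlonglongrightarrow> 0"
    unfolding L2norm_def using tendsto_real_sqrt by fastforce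
  from order_tendstoD(2)[OF this e] obtain m where "L2norm ?M (\<lambda>x. f x - g m x) < e"
    by (auto simp: eventually_sequentially)
  then show ?thesis using dom by blast
qed

text \<open>Since \<open>ip x x ^ n\<close> is the squared norm of the \<open>n\<close>-th tensor power of \<open>x\<close>, the family of
  these coordinates spreads the weight \<open>\<gamma>(\<parallel>x\<parallel>\<^sup>2)\<close> over all tensor degrees.\<close>
definition tensor_embedding :: "(nat \<Rightarrow> real) \<Rightarrow> ('a \<Rightarrow> 'i \<Rightarrow> real) \<Rightarrow> ('a \<Rightarrow> complex) \<Rightarrow> 'i list \<times> 'a \<Rightarrow> complex" where
  "tensor_embedding a c f =
    (\<lambda>(w, x). complex_of_real (sqrt (a (length w)) * prod_list (map (c x) w)) * f x)"

lemma tensor_embedding_measurable: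
  fixes c :: "'a::euclidean_space \<Rightarrow> 'i::finite \<Rightarrow> real"
  assumes c: "\<And>i. (\<lambda>x. c x i) \<in> borel_measurable borel" and f: "f \<in> borel_measurable borel"
  shows "tensor_embedding a c f \<in> borel_measurable lists_lborel"
proof -
  have [measurable]: "(\<lambda>x. prod_list (map (c x) w)) \<in> borel_measurable borel" for w
    by (induction w) (auto intro: borel_measurable_times c)
  note f [measurable]
  show ?thesis
    unfolding measurable_lists_lborel tensor_embedding_def split_conv by measurable
qed

text \<open>Tonelli, with the lists grouped by length: degree \<open>n\<close> contributes
  \<open>a n * t ^ n\<close> times the squared modulus of \<open>f x\<close>, and summation over
  \<open>n\<close> restores the power series. As infinite values are allowed, the identity also
  decides square integrability.\<close>

lemma nn_integral_tensor_embedding: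
  fixes c :: "'a::euclidean_space \<Rightarrow> 'i::finite \<Rightarrow> real"
  assumes c: "\<And>i. (\<lambda>x. c x i) \<in> borel_measurable borel" and f: "f \<in> borel_measurable borel"
    and a: "\<forall>n. a n \<ge> 0" and s: "\<And>t. summable (\<lambda>n. a n * t ^ n)"
  shows "(\<integral>\<^sup>+z. ennreal ((cmod (tensor_embedding a c f z))\<^sup>2) \<partial>lists_lborel)
    = (\<integral>\<^sup>+x. ennreal (gamma_real a (\<Sum>i\<in>UNIV. (c x i)\<^sup>2)) * ennreal ((cmod (f x))\<^sup>2) \<partial>lborel)"
proof -
  note [measurable] = tensor_embedding_measurable[OF c f]
  have "(\<integral>\<^sup>+z. ennreal ((cmod (tensor_embedding a c f z))\<^sup>2) \<partial>lists_lborel)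
    = (\<integral>\<^sup>+x. \<integral>\<^sup>+w. ennreal ((cmod (tensor_embedding a c f (w, x)))\<^sup>2) \<partial>count_space UNIV \<partial>lborel)"
    by (rule nn_integral_lists_lborel') measurable
  also have "\<dots> = (\<integral>\<^sup>+x. ennreal (gamma_real a (\<Sum>i\<in>UNIV. (c x i)\<^sup>2)) * ennreal ((cmod (f x))\<^sup>2) \<partial>lborel)"
  proof (rule nn_integral_cong)
    fix x
    let ?t = "\<Sum>i\<in>UNIV. (c x i)\<^sup>2" and ?y = "(cmod (f x))\<^sup>2"
    have t: "?t \<ge> 0" by (simp add: sum_nonneg)
    have "(\<integral>\<^sup>+w. ennreal ((cmod (tensor_embedding a c f (w, x)))\<^sup>2) \<partial>count_space UNIV)
        = (\<Sum>n. \<Sum>w | length w = n. ennreal ((cmod (tensor_embedding a c f (w, x)))\<^sup>2))"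
      by (rule nn_integral_lists_by_length)
    also have "\<dots> = (\<Sum>n. ennreal (a n * ?t ^ n) * ennreal ?y)"
    proof (rule suminf_cong)
      fix n
      have "(\<Sum>w | length w = n. (cmod (tensor_embedding a c f (w, x)))\<^sup>2)
          = (\<Sum>w | length w = n. (prod_list (map (c x) w))\<^sup>2 * (a n * ?y))"
        using a by (intro sum.cong refl)
          (simp add: tensor_embedding_def norm_mult power_mult_distrib mult_ac)
      also have "\<dots> = a n * ?t ^ n * ?y"
        unfolding sum_distrib_right[symmetric] sum_monomial_squares by (simp add: mult_ac)
      finally show "(\<Sum>w | length w = n. ennreal ((cmod (tensor_embedding a c f (w, x)))\<^sup>2))
          = ennreal (a n * ?t ^ n) * ennreal ?y"
        using a t by (simp add: ennreal_mult)
    qed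
    also have "\<dots> = (\<Sum>n. ennreal (a n * ?t ^ n)) * ennreal ?y" by (rule ennreal_suminf_multc)
    also have "\<dots> = ennreal (gamma_real a ?t) * ennreal ?y"
      unfolding gamma_real_def using a t s by (subst suminf_ennreal2) auto
    finally show "(\<integral>\<^sup>+w. ennreal ((cmod (tensor_embedding a c f (w, x)))\<^sup>2) \<partial>count_space UNIV)
      = ennreal (gamma_real a ?t) * ennreal ?y" .
  qed
  finally show ?thesis .
qed

text \<open>\<open>Q\<close> takes the coordinates of \<open>A x\<close> back to those of
  \<open>x\<close>, and its Kronecker powers do the same for pure tensors. Hence the embedding
  intertwines composition with \<open>A\<close> and \<open>T\<close>, pointwise and for every
  function \<open>f\<close>.\<close>

lemma (in tensor_pullback) T_tensor_embedding:
  assumes "\<And>x i. (\<Sum>j\<in>UNIV. Q i j * c (A x) j) = c x i"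
  shows "T (tensor_embedding a c f) = tensor_embedding a c (f \<circ> A)"
proof (rule ext, clarify)
  fix w :: "'i list" and x
  have "T (tensor_embedding a c f) (w, x)
      = complex_of_real (sqrt (a (length w)) *
        (\<Sum>v | length v = length w. tensor_coeff Q w v * prod_list (map (c (A x)) v))) * f (A x)"
    unfolding T_def tensor_embedding_def
    by (simp add: sum_distrib_left sum_distrib_right mult_ac)
  also have "\<dots> = tensor_embedding a c (f \<circ> A) (w, x)"
    by (simp add: tensor_coeff_monomial assms tensor_embedding_def)
  finally show "T (tensor_embedding a c f) (w, x) = tensor_embedding a c (f \<circ> A) (w, x)" .
qed

theorem theorem32:
  fixes a :: "nat \<Rightarrow> real"
    and ip :: "real^'n \<Rightarrow> real^'n \<Rightarrow> real"
    and A :: "real^'n \<Rightarrow> real^'n"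
  assumes "\<forall>n. a n \<ge> 0"
    and "\<exists>k\<ge>1. a k > 0"
    and "\<forall>z::complex. summable (\<lambda>n. complex_of_real (a n) * z ^ n)"
    and "is_inner_product ip"
    and "linear A" and "bij A"
    and "\<exists>B. linear B \<and> (\<forall>x y. ip (A x) y = ip x (B y)) \<and> A \<circ> B = B \<circ> A"
  shows "subnormal_L2 (mu_gamma a ip) (comp_dom (mu_gamma a ip) A) (\<lambda>f. f \<circ> A)"
proof -
  note ip = assms(4)
  note summable = gamma_real_summable[OF assms(3)]
  obtain As where As: "linear As" "\<And>x y. ip (A x) y = ip x (As y)" "A \<circ> As = As \<circ> A"
    using assms(7) by blast
  from ip_orthonormal_basis[OF ip] obtain b :: "'n \<Rightarrow> real^'n"
    where "\<forall>x. x = (\<Sum>i\<in>UNIV. ip x (b i) *\<^sub>R b i)"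
    by (elim exE conjE)
  note b = this[rule_format]
  obtain d where d: "d > 0" and pullback: "\<And>h. h \<in> borel_measurable borel \<Longrightarrow>
      (\<integral>\<^sup>+x. h (A x) \<partial>lborel) = ennreal d * (\<integral>\<^sup>+x. h x \<partial>lborel)"
    using nn_integral_lborel_linear[OF assms(5,6)] by blast
  define B where "B = inv A"
  have B: "linear B" unfolding B_def using assms(5,6) by (metis bij_is_inj inj_linear_imp_inv_linear)
  have AB: "A (B x) = x" "B (A x) = x" for x
    unfolding B_def using assms(6) by (simp_all add: bij_is_surj surj_f_inv_f bij_is_inj)
  have meas [measurable]: "A \<in> borel_measurable borel" "B \<in> borel_measurable borel"
    using assms(5) B by (simp_all add: borel_measurable_continuous_onI linear_continuous_on linear_conv_bounded_linear)
  define Q where "Q i j = ip (inv A (b j)) (b i)" for i j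
  note Q = normal_inverse_matrix[OF ip b assms(5,6) As, folded Q_def]
  interpret tensor_pullback A B d Q
    by unfold_locales (simp_all add: meas AB d pullback Q(1))
  define c where "c x i = ip x (b i)" for x i
  have c_meas [measurable]: "(\<lambda>x. c x i) \<in> borel_measurable borel" for i
    unfolding c_def using linear_ip_left[OF ip]
    by (simp add: borel_measurable_continuous_onI linear_continuous_on linear_conv_bounded_linear)
  have ip_c: "ip x x = (\<Sum>i\<in>UNIV. (c x i)\<^sup>2)" for x
    unfolding c_def power2_eq_square by (rule ip_expand[OF ip b])
  have ip_meas [measurable]: "(\<lambda>x. ip x x) \<in> borel_measurable borel" unfolding ip_c by measurable
  let ?\<mu> = "mu_gamma a ip"
  let ?V = "tensor_embedding a c"
  have L2_mu: "f \<in> L2set ?\<mu> \<longleftrightarrow> f \<in> borel_measurable borel \<and>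
      (\<integral>\<^sup>+z. ennreal ((cmod (?V f z))\<^sup>2) \<partial>lists_lborel) < \<infinity>" for f
  proof (cases "f \<in> borel_measurable borel")
    case True
    show ?thesis
      unfolding mu_gamma_def nn_integral_tensor_embedding[OF c_meas True assms(1) summable]
      using True by (subst L2set_density) (simp_all add: ip_c)
  next
    case False
    then show ?thesis by (simp add: mu_gamma_def L2set_iff)
  qed
  have V_L2: "?V f \<in> L2set lists_lborel" if "f \<in> L2set ?\<mu>" for f
    unfolding L2set_iff[of "?V f"] using that[unfolded L2_mu]
    by (auto intro: tensor_embedding_measurable[OF c_meas])
  have V_norm: "L2norm lists_lborel (?V f) = L2norm ?\<mu> f" if f: "f \<in> L2set ?\<mu>" for f
  proof -
    have m [measurable]: "f \<in> borel_measurable borel" using f by (simp add: L2_mu)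
    have "ennreal ((L2norm lists_lborel (?V f))\<^sup>2) = ennreal ((L2norm ?\<mu> f)\<^sup>2)"
      unfolding nn_L2norm[OF V_L2[OF f], symmetric] nn_L2norm[OF f, symmetric]
        nn_integral_tensor_embedding[OF c_meas m assms(1) summable]
      by (simp add: mu_gamma_def nn_integral_density ip_c)
    then show ?thesis by (simp add: L2norm_nonneg)
  qed
  have V_add: "?V (\<lambda>x. f x + g x) = (\<lambda>z. ?V f z + ?V g z)" for f g
    by (auto simp: tensor_embedding_def distrib_left)
  have V_scale: "?V (\<lambda>x. k * f x) = (\<lambda>z. k * ?V f z)" for k f
    by (auto simp: tensor_embedding_def)
  \<comment> \<open>The extension space must have its carrier in
    \<open>(real^'n \<Rightarrow> complex) set\<close>, while tensor fields live on
    \<open>'n list \<times> (real^'n)\<close>; \<open>j\<close> and \<open>r\<close> bridge the two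
    types.\<close>
  have "infinite (UNIV :: (real^'n) set)" by (rule infinite_UNIV_char_0)
  from ex_surj_prod_countable[OF this, where 'c = "'n list"]
  obtain j :: "real^'n \<Rightarrow> 'n list \<times> (real^'n)" where "surj j" by blast
  from l2_model_image[OF this, of "lists_lborel"]
  obtain r :: "('n list \<times> (real^'n) \<Rightarrow> complex) \<Rightarrow> (real^'n \<Rightarrow> complex) set"
    where r: "l2_model lists_lborel r" by blast
  interpret P: exhausted_normal_pair lists_lborel r E T S by (rule exhausted_normal_pair[OF r])
  have TV: "T (?V f) = ?V (f \<circ> A)" for f
    by (rule T_tensor_embedding) (simp add: Q(2) c_def)
  have dense: "\<forall>f\<in>L2set ?\<mu>. \<forall>e>0. \<exists>g\<in>comp_dom ?\<mu> A. L2norm ?\<mu> (\<lambda>x. f x - g x) < e"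
    unfolding mu_gamma_def
    by (intro ballI allI impI dense_comp_dom[OF meas _ BA pullback]) measurable
  show ?thesis
    unfolding subnormal_L2_def
  \<comment> \<open>Witnesses: the space \<open>P.H\<close>, the embedding
    \<open>\<lambda>f. r (?V f)\<close>, and the normal operator \<open>P.opr\<close> on
    \<open>P.opr_dom\<close>.\<close>
  proof (rule conjI[OF dense], intro exI conjI ballI allI)
    show "hilbert_space P.H" by (rule P.hilbert_space_H)
    show "normal_op P.H P.opr_dom P.opr" by (rule P.normal_opr)
    fix f assume f: "f \<in> L2set ?\<mu>"
    show "r (?V f) \<in> hcarrier P.H" "hnorm P.H (r (?V f)) = L2norm ?\<mu> f"
      using f by (simp_all add: P.carrier P.norm V_L2 V_norm)
    show "r (?V (\<lambda>x. k * f x)) = hscale P.H k (r (?V f))" for k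
      using f by (simp add: V_scale P.scale V_L2)
    show "r (?V (\<lambda>x. f x + g x)) = hadd P.H (r (?V f)) (r (?V g))" if "g \<in> L2set ?\<mu>" for g
      using f that by (simp add: V_add P.add V_L2)
  next
    \<comment> \<open>Both \<open>f\<close> and \<open>f \<circ> A\<close> are square integrable, so
      the intertwining relation puts \<open>?V f\<close> into the maximal domain of
      \<open>T\<close>.\<close>
    fix f assume "f \<in> comp_dom ?\<mu> A"
    then have "?V f \<in> L2set lists_lborel" "T (?V f) \<in> L2set lists_lborel"
      by (simp_all add: comp_dom_def TV V_L2)
    then show "r (?V f) \<in> P.opr_dom" "P.opr (r (?V f)) = r (?V (f \<circ> A))"
      by (simp_all add: P.opr_dom_iff P.opr_eq TV)
  qed
qed

end
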